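(* Let $(\sigma,\tau_0,\tau_1)$ be one of the 18 triples listed in the context, with corresponding Banach space $W$. If $T_{\sigma,\tau_0,\tau_1}$ is ergodic, then the eigenvalue $1$ of $\mathcal{L}_{T_{\sigma,\tau_0,\tau_1}}:W\to W$ has multiplicity $1$ (that is, the eigenspace for the eigenvalue $1$ is one-dimensional).
   Context: Let $\triangle=\{(x,y)\in\mathbb{R}^2: 0<y<x<1\}$ and let $\mathcal{C}(\triangle)$ be the space of real-valued continuous functions on $\triangle$. Ergodicity is with respect to Lebesgue measure on $\triangle$: every measurable set $A$ with $T^{-1}A=A$ (mod null sets) is null or has null complement. Triangle partition maps. The elements of $S_3$ are written $e,12,13,23,123,132$ and identified with the $3\times 3$ permutation matrices acting on column vectors $v=(v_1,v_2,v_3)^T$ by: $e\,v=v$, $(12)v=(v_2,v_1,v_3)^T$, $(13)v=(v_3,v_2,v_1)^T$, $(23)v=(v_1,v_3,v_2)^T$, $(123)v=(v_2,v_3,v_1)^T$, $(132)v=(v_3,v_1,v_2)^T$. Put $$B=\begin{pmatrix}1&1&1\\0&1&1\\0&0&1\end{pmatrix},\quad A_0=\begin{pmatrix}0&0&1\\1&0&0\\0&1&1\end{pmatrix},\quad A_1=\begin{pmatrix}1&0&1\\0&1&0\\0&0&1\end{pmatrix}.$$ For $(\sigma,\tau_0,\tau_1)\in S_3^3$ let $F_0=\sigma A_0\tau_0$, $F_1=\sigma A_1\tau_1$ (matrix products). For $k\ge 0$ and $(x,y)\in\triangle$ write $(d_k,p_k,q_k)^T=BF_1^kF_0B^{-1}(1,x,y)^T$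 and $S_k(x,y)=(p_k/d_k,\,q_k/d_k)$; here $d_k>0$. $S_k$ maps $\triangle$ bijectively onto an open subtriangle $\triangle_k\subset\triangle$, the $\triangle_k$ are pairwise disjoint and (for the triples considered here) cover $\triangle$ up to a null set, and the triangle partition map $T_{\sigma,\tau_0,\tau_1}$ is defined on $\bigcup_k\triangle_k$ by $T_{\sigma,\tau_0,\tau_1}=S_k^{-1}$ on $\triangle_k$. Its transfer operator is $$\mathcal{L}_{T_{\sigma,\tau_0,\tau_1}}f(x,y)=\sum_{(a,b):T_{\sigma,\tau_0,\tau_1}(a,b)=(x,y)}\frac{f(a,b)}{|\mathrm{Jac}(T_{\sigma,\tau_0,\tau_1})(a,b)|}=\sum_{k=0}^\infty \frac{1}{d_k(x,y)^3}\,f(S_k(x,y)).$$ The corresponding Banach space is $W=\{f\in\mathcal{C}(\triangle):\exists\,C\in\mathbb{R},\ |g f|<C\text{ on }\triangle\}$ with norm $\|f\|=\sup_\triangle|gf|$. The 18 triples (those for which an eigenfunction $h\in W$ with $\mathcal{L}h=h$ is known), with $g$ and $h$, are: $(e,e,e)$: $g=x$, $h=\frac{1}{x(1+y)}$; $(e,23,e)$, $(e,132,e)$, $(13,23,13)$, $(13,132,13)$: $g=x(1-y)$, $h=\frac1{x(1-y)}$; $(12,12,12)$: $g=1-x+y$, $h=\frac{1}{(1+y)(1-x+y)}$; $(12,13,12)$, $(12,123,12)$, $(123,13,132)$, $(123,123,132)$: $g=(1-y)(1-x+y)$, $h=\frac1{(1-y)(1-x+y)}$; $(13,13,13)$: $g=1-y$,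 $h=\frac{1}{(x-2)(1-y)}$; $(23,e,23)$, $(23,12,23)$, $(132,e,123)$, $(132,12,123)$: $g=x(1-x+y)$, $h=\frac1{x(1-x+y)}$; $(23,23,23)$: $g=x$, $h=\frac1{x(1+x-y)}$; $(123,132,132)$: $g=(1-y)(1+x-y)$, $h=\frac1{(1-y)(1+x-y)}$; $(132,123,123)$: $g=1-x+y$, $h=\frac1{(x-2)(1-x+y)}$. *)

theory Defs
  imports "HOL-Analysis.Analysis" "HOL-Library.Function_Algebras"
begin

definition open_triangle :: "(real^2) set" where
  "open_triangle = {p. 0 < p$2 \<and> p$2 < p$1 \<and> p$1 < 1}"

datatype S3 = S3_e | S3_12 | S3_13 | S3_23 | S3_123 | S3_132

(* Rows are listed: S3_123 sends (v1, v2, v3) to (v2, v3, v1), S3_132 sends it to (v3, v1, v2). *)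
primrec perm_mat :: "S3 \<Rightarrow> real^3^3" where
  "perm_mat S3_e   = vector [vector [1,0,0], vector [0,1,0], vector [0,0,1]]"
| "perm_mat S3_12  = vector [vector [0,1,0], vector [1,0,0], vector [0,0,1]]"
| "perm_mat S3_13  = vector [vector [0,0,1], vector [0,1,0], vector [1,0,0]]"
| "perm_mat S3_23  = vector [vector [1,0,0], vector [0,0,1], vector [0,1,0]]"
| "perm_mat S3_123 = vector [vector [0,1,0], vector [0,0,1], vector [1,0,0]]"
| "perm_mat S3_132 = vector [vector [0,0,1], vector [1,0,0], vector [0,1,0]]"

definition mat_B :: "real^3^3" where
  "mat_B = vector [vector [1,1,1], vector [0,1,1], vector [0,0,1]]"

definition mat_A0 :: "real^3^3" where
  "mat_A0 = vector [vector [0,0,1], vector [1,0,0], vector [0,1,1]]"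

definition mat_A1 :: "real^3^3" where
  "mat_A1 = vector [vector [1,0,1], vector [0,1,0], vector [0,0,1]]"

definition mat_F0 :: "S3 \<Rightarrow> S3 \<Rightarrow> real^3^3" where
  "mat_F0 \<sigma> \<tau>0 = perm_mat \<sigma> ** mat_A0 ** perm_mat \<tau>0"

definition mat_F1 :: "S3 \<Rightarrow> S3 \<Rightarrow> real^3^3" where
  "mat_F1 \<sigma> \<tau>1 = perm_mat \<sigma> ** mat_A1 ** perm_mat \<tau>1"

(* (d_k, p_k, q_k). Since (^) on vectors of vectors is not the matrix power,
   F1^k F0 is written by iterating left multiplication by F1. *)
definition branch_vec :: "S3 \<Rightarrow> S3 \<Rightarrow> S3 \<Rightarrow> nat \<Rightarrow> real^2 \<Rightarrow> real^3" where
  "branch_vec \<sigma> \<tau>0 \<tau>1 k p =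
     (mat_B ** (((**) (mat_F1 \<sigma> \<tau>1) ^^ k) (mat_F0 \<sigma> \<tau>0)) ** matrix_inv mat_B)
       *v vector [1, p$1, p$2]"

definition branch :: "S3 \<Rightarrow> S3 \<Rightarrow> S3 \<Rightarrow> nat \<Rightarrow> real^2 \<Rightarrow> real^2" where
  "branch \<sigma> \<tau>0 \<tau>1 k p =
     (let v = branch_vec \<sigma> \<tau>0 \<tau>1 k p in vector [v$2 / v$1, v$3 / v$1])"

definition subtriangle :: "S3 \<Rightarrow> S3 \<Rightarrow> S3 \<Rightarrow> nat \<Rightarrow> (real^2) set" where
  "subtriangle \<sigma> \<tau>0 \<tau>1 k = branch \<sigma> \<tau>0 \<tau>1 k ` open_triangle"

definition tpm_dom :: "S3 \<Rightarrow> S3 \<Rightarrow> S3 \<Rightarrow> (real^2) set" where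
  "tpm_dom \<sigma> \<tau>0 \<tau>1 = (\<Union>k. subtriangle \<sigma> \<tau>0 \<tau>1 k)"

(* Triangle partition map; only its values on tpm_dom are meaningful. *)
definition tpm :: "S3 \<Rightarrow> S3 \<Rightarrow> S3 \<Rightarrow> real^2 \<Rightarrow> real^2" where
  "tpm \<sigma> \<tau>0 \<tau>1 p =
     the_inv_into open_triangle (branch \<sigma> \<tau>0 \<tau>1 (THE k. p \<in> subtriangle \<sigma> \<tau>0 \<tau>1 k)) p"

definition jacobian_det :: "(real^'n \<Rightarrow> real^'n) \<Rightarrow> real^'n \<Rightarrow> real" where
  "jacobian_det T p = det (matrix (frechet_derivative T (at p)))"

(* Transfer operator of a map T with domain D, with no integrability or summability assumption on f
   built in. If T maps D into a set X, the value is 0 outside X, because the sum is empty there. *)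
definition transfer_op :: "(real^'n) set \<Rightarrow> (real^'n \<Rightarrow> real^'n) \<Rightarrow> (real^'n \<Rightarrow> real) \<Rightarrow> real^'n \<Rightarrow> real"
  where "transfer_op D T f p = (\<Sum>\<^sub>\<infinity>a\<in>{a \<in> D. T a = p}. f a / \<bar>jacobian_det T a\<bar>)"

(* Ergodicity of a map T that is defined on the subset D of the space of M. *)
definition ergodic_on :: "'a measure \<Rightarrow> 'a set \<Rightarrow> ('a \<Rightarrow> 'a) \<Rightarrow> bool" where
  "ergodic_on M D T \<longleftrightarrow>
     (\<forall>A\<in>sets M. sym_diff {p \<in> D. T p \<in> A} A \<in> null_sets M \<longrightarrow>
        A \<in> null_sets M \<or> space M - A \<in> null_sets M)"

(* The space W of the weight g. A function on the triangle is represented by its extension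
   by 0 to the plane, so that equality of functions is equality on the triangle. *)
definition weighted_space :: "(real \<Rightarrow> real \<Rightarrow> real) \<Rightarrow> (real^2 \<Rightarrow> real) set" where
  "weighted_space g =
     {f. continuous_on open_triangle f \<and> (\<forall>p. p \<notin> open_triangle \<longrightarrow> f p = 0) \<and>
         (\<exists>C. \<forall>p\<in>open_triangle. \<bar>g (p$1) (p$2) * f p\<bar> < C)}"

interpretation real_fun: vector_space "\<lambda>(c::real) (f::'a \<Rightarrow> real) x. c * f x"
  by unfold_locales (auto simp: fun_eq_iff algebra_simps)

definition eigenspace ::
  "(('a \<Rightarrow> real) \<Rightarrow> 'a \<Rightarrow> real) \<Rightarrow> ('a \<Rightarrow> real) set \<Rightarrow> real \<Rightarrow> ('a \<Rightarrow> real) set" where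
  "eigenspace L V c = {f \<in> V. L f = (\<lambda>x. c * f x)}"

(* The triples (\<sigma>, \<tau>0, \<tau>1) together with the weight g of the corresponding space. *)
definition tpm_weights :: "((S3 \<times> S3 \<times> S3) \<times> (real \<Rightarrow> real \<Rightarrow> real)) set" where
  "tpm_weights =
    {((S3_e, S3_e, S3_e),         \<lambda>x y. x),
     ((S3_e, S3_23, S3_e),        \<lambda>x y. x * (1 - y)),
     ((S3_e, S3_132, S3_e),       \<lambda>x y. x * (1 - y)),
     ((S3_13, S3_23, S3_13),      \<lambda>x y. x * (1 - y)),
     ((S3_13, S3_132, S3_13),     \<lambda>x y. x * (1 - y)),
     ((S3_12, S3_12, S3_12),      \<lambda>x y. 1 - x + y),
     ((S3_12, S3_13, S3_12),      \<lambda>x y. (1 - y) * (1 - x + y)),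
     ((S3_12, S3_123, S3_12),     \<lambda>x y. (1 - y) * (1 - x + y)),
     ((S3_123, S3_13, S3_132),    \<lambda>x y. (1 - y) * (1 - x + y)),
     ((S3_123, S3_123, S3_132),   \<lambda>x y. (1 - y) * (1 - x + y)),
     ((S3_13, S3_13, S3_13),      \<lambda>x y. 1 - y),
     ((S3_23, S3_e, S3_23),       \<lambda>x y. x * (1 - x + y)),
     ((S3_23, S3_12, S3_23),      \<lambda>x y. x * (1 - x + y)),
     ((S3_132, S3_e, S3_123),     \<lambda>x y. x * (1 - x + y)),
     ((S3_132, S3_12, S3_123),    \<lambda>x y. x * (1 - x + y)),
     ((S3_23, S3_23, S3_23),      \<lambda>x y. x),
     ((S3_123, S3_132, S3_132),   \<lambda>x y. (1 - y) * (1 + x - y)),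
     ((S3_132, S3_123, S3_123),   \<lambda>x y. 1 - x + y)}"

end

theory Submission
  imports Defs
begin

text \<open>
  Let \<open>L\<close> be the transfer operator of a triangle partition map \<open>T\<close>. The claim is that the
  \<open>L\<close>-fixed functions in the weighted space are exactly the multiples of one positive fixed
  density \<open>h\<close>.

  The first half is a general fact about a map \<open>T\<close> with countably many full branches on an open
  set and a positive continuous integrable density \<open>h\<close> with \<open>L h = h\<close>. If \<open>w\<close> is continuous,
  \<open>\<bar>w\<bar> \<le> C h\<close> and \<open>L w = w\<close>, then for every open set \<open>A\<close> the integrals of \<open>w\<close> over \<open>A\<close> and over
  \<open>T\<^sup>-\<^sup>1 A\<close> agree, by a change of variables on each branch and dominated convergence
  (\<open>integral_preimage_eq\<close>). Apply this to \<open>A = {u > 0}\<close> and \<open>w = u\<close>: on \<open>A - T\<^sup>-\<^sup>1 A\<close> the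
  function \<open>u\<close> is positive and on \<open>T\<^sup>-\<^sup>1 A - A\<close> it is not, so equality of the two integrals forces
  \<open>A - T\<^sup>-\<^sup>1 A\<close> to be null. Applying it again with \<open>w = h\<close> shows that \<open>T\<^sup>-\<^sup>1 A - A\<close> is null as well,
  so \<open>A\<close> is invariant and ergodicity makes it null or conull
  (\<open>null_or_conull_positive_set\<close>). If \<open>f\<close> is fixed and \<open>f / h\<close> takes values on both sides of
  some \<open>c\<close>, then \<open>u = f - c h\<close> has disjoint nonempty open sets of positivity and of
  negativity, which contradicts this dichotomy. Hence \<open>f / h\<close> is constant.

  The second half provides the branches and the density. In barycentric coordinates
  \<open>(1 - x, x - y, y)\<close> the triangle is the projectivised positive cone of \<open>\<real>\<^sup>3\<close>, the branch \<open>S\<^sub>k\<close> is the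
  projective action of \<open>F\<^sub>1\<^sup>k F\<^sub>0\<close>, which has determinant \<open>\<plusminus>1\<close>, and the Jacobian \<open>1 / d\<^sub>k\<^sup>3\<close> becomes
  homogeneity of degree \<open>-3\<close>: a function \<open>H\<close> on the cone that is homogeneous of that degree
  restricts to a fixed density as soon as the sum of \<open>H (F\<^sub>1\<^sup>k F\<^sub>0 v)\<close> over \<open>k\<close> is \<open>H v\<close>. Up to
  conjugation by a permutation of the coordinates, the 18 triples are \<open>(e, \<kappa>, e)\<close> with \<open>\<kappa>\<close> among
  \<open>e, 23, 132\<close> (\<open>tpm_weights_conjugate\<close>). For these, \<open>F\<^sub>1\<^sup>k\<close> adds \<open>k\<close> times the third coordinate to
  the first one, and the series telescopes (\<open>cone_density_fixed\<close>). The density is integrable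
  because its singularities are at most of order \<open>1 / r\<close> at the vertices
  (\<open>integrable_density\<close>), and it is comparable to the reciprocal of the weight, so
  that the weighted space is the space of continuous functions bounded by a multiple of \<open>h\<close>.
\<close>

section \<open>Change of variables for real-valued functions\<close>

lemma set_integrable_change_of_variables:
  fixes g :: "real^'n::{finite,wellorder} \<Rightarrow> real^'n::_" and f :: "real^'n::_ \<Rightarrow> real"
  assumes A: "A \<in> sets lebesgue"
    and der: "\<And>x. x \<in> A \<Longrightarrow> (g has_derivative g' x) (at x within A)"
    and inj: "inj_on g A"
  shows "set_integrable lebesgue (g ` A) f \<longleftrightarrow>
    set_integrable lebesgue A (\<lambda>x. \<bar>det (matrix (g' x))\<bar> * f (g x))"
  using absolutely_integrable_change_of_variables[OF A der inj, of "\<lambda>x. vec (f x) :: real^1"]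
  by (simp add: absolutely_integrable_on_1_iff)

lemma set_integral_change_of_variables:
  fixes g :: "real^'n::{finite,wellorder} \<Rightarrow> real^'n::_" and f :: "real^'n::_ \<Rightarrow> real"
  assumes A: "A \<in> sets lebesgue"
    and der: "\<And>x. x \<in> A \<Longrightarrow> (g has_derivative g' x) (at x within A)"
    and inj: "inj_on g A"
    and int: "set_integrable lebesgue (g ` A) f"
  shows "(LINT x:g ` A|lebesgue. f x) = (LINT x:A|lebesgue. \<bar>det (matrix (g' x))\<bar> * f (g x))"
proof -
  have "integral (g ` A) (\<lambda>x. vec (f x) :: real^1) =
      integral A (\<lambda>x. \<bar>det (matrix (g' x))\<bar> *\<^sub>R (vec (f (g x)) :: real^1))"
    by (rule integral_change_of_variables[OF A der inj]) (simp_all add: absolutely_integrable_on_1_iff int)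
  then have "integral (g ` A) f = integral A (\<lambda>x. \<bar>det (matrix (g' x))\<bar> * f (g x))"
    by (simp add: integral_on_1_eq vec_eq_iff)
  then show ?thesis
    using int set_integrable_change_of_variables[OF A der inj, of f]
    by (simp add: set_lebesgue_integral_eq_integral)
qed

section \<open>Maps with countably many full branches\<close>

text \<open>
  The branches of \<open>T\<close> are full: each maps its piece \<open>S k ` U\<close> of \<open>D\<close> onto all of \<open>U\<close>. They are given
  through their inverses \<open>S k\<close>, because the transfer operator and the change of variables only
  involve these.
\<close>
locale full_branch_map =
  fixes U :: "(real^'n::{finite,wellorder}) set"
    and S :: "nat \<Rightarrow> real^'n::_ \<Rightarrow> real^'n::_"
    and S' :: "nat \<Rightarrow> real^'n::_ \<Rightarrow> real^'n::_ \<Rightarrow> real^'n::_"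
    and D :: "(real^'n::_) set"
    and T :: "real^'n::_ \<Rightarrow> real^'n::_"
  assumes open_U: "open U"
    and inj_S: "inj_on (S k) U"
    and S_in_U: "p \<in> U \<Longrightarrow> S k p \<in> U"
    and disjoint_S: "j \<noteq> k \<Longrightarrow> S j ` U \<inter> S k ` U = {}"
    and deriv_S: "p \<in> U \<Longrightarrow> (S k has_derivative S' k p) (at p)"
    and det_S: "p \<in> U \<Longrightarrow> det (matrix (S' k p)) \<noteq> 0"
    and D_eq: "D = (\<Union>k. S k ` U)"
    and T_S: "p \<in> U \<Longrightarrow> T (S k p) = p"
begin

definition jac :: "nat \<Rightarrow> real^'n::_ \<Rightarrow> real" where
  "jac k p = \<bar>det (matrix (S' k p))\<bar>"

lemma jac_pos: "p \<in> U \<Longrightarrow> 0 < jac k p"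
  using det_S[of p k] by (simp add: jac_def)

lemma continuous_on_S: "continuous_on U (S k)"
  by (meson deriv_S continuous_at_imp_continuous_on has_derivative_continuous)

lemma open_image_S: "open A \<Longrightarrow> A \<subseteq> U \<Longrightarrow> open (S k ` A)"
  by (meson continuous_on_S continuous_on_subset inj_S inj_on_subset invariance_of_domain)

text \<open>
  The branch images are open, so near \<open>S k p\<close> the map \<open>T\<close> is the inverse of \<open>S k\<close>, and the inverse
  function theorem for an injective continuous map applies.
\<close>
lemma jacobian_det_T:
  assumes p: "p \<in> U"
  shows "\<bar>jacobian_det T (S k p)\<bar> = 1 / jac k p"
proof -
  let ?M = "matrix (S' k p)"
  have lin: "linear (S' k p)"
    using deriv_S[OF p] has_derivative_linear by blast
  have "invertible ?M"
    using det_S[OF p] by (simp add: invertible_det_nz)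
  then obtain N where MN: "?M ** N = mat 1" "N ** ?M = mat 1"
    unfolding invertible_def by blast
  have "S' k p \<circ> (*v) N = id"
  proof
    fix x
    have "S' k p (N *v x) = ?M *v (N *v x)"
      using matrix_works[OF lin[folded linear_matrix_vector_mul_eq]] lin
      by (simp add: matrix_works)
    then show "(S' k p \<circ> (*v) N) x = id x"
      by (simp add: matrix_vector_mul_assoc MN)
  qed
  then have "(T has_derivative (*v) N) (at (S k p))"
    by (intro has_derivative_inverse_strong[OF open_U p continuous_on_S]) (auto simp: T_S deriv_S p)
  then have "frechet_derivative T (at (S k p)) = (*v) N"
    using frechet_derivative_at by metis
  then have "jacobian_det T (S k p) = det N"
    by (simp add: jacobian_det_def)
  moreover have "det ?M * det N = 1"
    using MN by (metis det_I det_mul)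
  ultimately show ?thesis
    by (metis abs_mult abs_one jac_def mult.commute nonzero_eq_divide_eq det_S p abs_eq_0)
qed

lemma fibre_T: "p \<in> U \<Longrightarrow> {a \<in> D. T a = p} = range (\<lambda>k. S k p)"
  by (auto simp: D_eq T_S)

lemma transfer_op_eq:
  assumes p: "p \<in> U"
  shows "transfer_op D T f p = (\<Sum>\<^sub>\<infinity>k. jac k p * f (S k p))"
proof -
  have "inj (\<lambda>k. S k p)"
    using disjoint_S p by (fastforce intro: injI)
  then show ?thesis
    unfolding transfer_op_def fibre_T[OF p]
    by (subst infsum_reindex) (auto simp: o_def jacobian_det_T[OF p] mult.commute)
qed

lemma transfer_op_outside: "p \<notin> U \<Longrightarrow> transfer_op D T f p = 0"
proof -
  assume "p \<notin> U"
  then have "{a \<in> D. T a = p} = {}"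
    by (auto simp: D_eq T_S)
  then show ?thesis
    by (simp only: transfer_op_def infsum_empty)
qed

lemma preimage_T: "A \<subseteq> U \<Longrightarrow> {p \<in> D. T p \<in> A} = (\<Union>k. S k ` A)"
  by (fastforce simp: D_eq T_S)

end

section \<open>Uniqueness of the fixed density of an ergodic map\<close>

locale full_branch_density = full_branch_map U S S' D T
  for U :: "(real^'n::{finite,wellorder}) set" and S S' D T +
  fixes h :: "real^'n::_ \<Rightarrow> real"
  assumes continuous_h: "continuous_on U h"
    and h_pos: "p \<in> U \<Longrightarrow> 0 < h p"
    and h_outside: "p \<notin> U \<Longrightarrow> h p = 0"
    and integrable_h: "set_integrable lebesgue U h"
    and h_fixed: "p \<in> U \<Longrightarrow> (\<lambda>k. jac k p * h (S k p)) sums h p"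
begin

lemma integrable_dominated:
  assumes w: "continuous_on U w" and bound: "\<And>p. p \<in> U \<Longrightarrow> \<bar>w p\<bar> \<le> C * h p"
    and A: "A \<in> sets lebesgue" "A \<subseteq> U"
  shows "set_integrable lebesgue A w"
proof -
  have "set_integrable lebesgue U (\<lambda>p. C * h p)"
    using integrable_h by simp
  moreover have "w \<in> borel_measurable (lebesgue_on U)"
    using w open_U by (simp add: continuous_imp_measurable_on_sets_lebesgue)
  then have "set_borel_measurable lebesgue U w"
    using open_U by (simp add: borel_measurable_restrict_space_iff set_borel_measurable_def)
  ultimately have "set_integrable lebesgue U w"
    by (rule set_integrable_bound) (use bound h_pos in \<open>fastforce\<close>)
  then show ?thesis
    using A by (rule set_integrable_subset)
qed

text \<open>
  Signed measures with density \<open>w\<close> are \<open>T\<close>-invariant when \<open>w\<close> is fixed. The partial sums of the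
  series for \<open>L w\<close> are bounded by \<open>C L h = C h\<close>, which is integrable. Open sets keep all
  measurability questions trivial, since the branches map open sets to open sets.
\<close>
lemma integral_preimage_eq:
  assumes w: "continuous_on U w" and bound: "\<And>p. p \<in> U \<Longrightarrow> \<bar>w p\<bar> \<le> C * h p"
    and fixed: "\<And>p. p \<in> U \<Longrightarrow> (\<lambda>k. jac k p * w (S k p)) sums w p"
    and A: "open A" "A \<subseteq> U"
  shows "(LINT p:A|lebesgue. w p) = (LINT p:{p \<in> D. T p \<in> A}|lebesgue. w p)"
proof -
  let ?v = "\<lambda>k p. jac k p * w (S k p)"
  note int = integrable_dominated[OF w bound]
  have SA: "open (S k ` A)" "S k ` A \<subseteq> U" for k
    using A S_in_U open_image_S by auto
  have intS: "set_integrable lebesgue (S k ` A) w" for k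
    using SA[of k] by (intro int) auto
  have cv: "set_integrable lebesgue A (?v k)" 
      "(LINT p:S k ` A|lebesgue. w p) = (LINT p:A|lebesgue. ?v k p)" for k
  proof -
    have "(S k has_derivative S' k p) (at p within A)" if "p \<in> A" for p
      using that A deriv_S has_derivative_at_withinI by blast
    moreover have "A \<in> sets lebesgue"
      using A by auto
    moreover have "inj_on (S k) A"
      by (rule inj_on_subset[OF inj_S A(2)])
    ultimately show "set_integrable lebesgue A (?v k)"
      "(LINT p:S k ` A|lebesgue. w p) = (LINT p:A|lebesgue. ?v k p)"
      unfolding jac_def
      using set_integrable_change_of_variables[of A "S k" "S' k" w]
        set_integral_change_of_variables[of A "S k" "S' k" w] intS[of k] by simp_all
  qed
  have "(\<lambda>n. LINT p:A|lebesgue. (\<Sum>k<n. ?v k p)) \<longlonglongrightarrow> (LINT p:A|lebesgue. w p)"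
    unfolding set_lebesgue_integral_def
  proof (rule integral_dominated_convergence)
    have "A \<in> sets lebesgue" using A by auto
    then show "integrable lebesgue (\<lambda>p. indicat_real A p *\<^sub>R (C * h p))"
      using set_integrable_subset[OF integrable_h _ A(2)] unfolding set_integrable_def[symmetric]
      by simp
    show "(\<lambda>p. indicat_real A p *\<^sub>R w p) \<in> borel_measurable lebesgue"
      using int[of A] A unfolding set_integrable_def by auto
    show "(\<lambda>p. indicat_real A p *\<^sub>R (\<Sum>k<n. ?v k p)) \<in> borel_measurable lebesgue" for n
    proof -
      have "set_integrable lebesgue A (\<lambda>p. \<Sum>k<n. ?v k p)"
        using cv(1) by (rule absolutely_integrable_sum[OF finite_lessThan])
      then show ?thesis
        unfolding set_integrable_def by (rule borel_measurable_integrable)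
    qed
    show "AE p in lebesgue. (\<lambda>n. indicat_real A p *\<^sub>R (\<Sum>k<n. ?v k p)) \<longlonglongrightarrow> indicat_real A p *\<^sub>R w p"
      using fixed A by (intro AE_I2) (auto simp: indicator_def sums_def)
    show "AE p in lebesgue. norm (indicat_real A p *\<^sub>R (\<Sum>k<n. ?v k p)) \<le> indicat_real A p *\<^sub>R (C * h p)" for n
    proof (rule AE_I2)
      fix p
      show "norm (indicat_real A p *\<^sub>R (\<Sum>k<n. ?v k p)) \<le> indicat_real A p *\<^sub>R (C * h p)"
      proof (cases "p \<in> A")
        case True
        then have p: "p \<in> U" using A by auto
        have C: "0 \<le> C"
          using bound[OF p] h_pos[OF p] by (smt (verit) mult_neg_pos)
        have "norm (\<Sum>k<n. ?v k p) \<le> (\<Sum>k<n. \<bar>?v k p\<bar>)"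
          by auto
        also have "\<dots> \<le> (\<Sum>k<n. C * (jac k p * h (S k p)))"
        proof (rule sum_mono)
          fix k
          have "\<bar>?v k p\<bar> = jac k p * \<bar>w (S k p)\<bar>"
            using jac_pos[OF p, of k] by (simp add: abs_mult)
          also have "\<dots> \<le> jac k p * (C * h (S k p))"
            using jac_pos[OF p, of k] bound[OF S_in_U[OF p]] by (intro mult_left_mono) auto
          finally show "\<bar>?v k p\<bar> \<le> C * (jac k p * h (S k p))"
            by (simp add: mult_ac)
        qed
        also have "\<dots> = C * (\<Sum>k<n. jac k p * h (S k p))"
          by (simp add: sum_distrib_left)
        also have "\<dots> \<le> C * h p"
        proof (rule mult_left_mono[OF _ C])
          have "0 \<le> jac k p * h (S k p)" for k
            using jac_pos[OF p, of k] h_pos[OF S_in_U[OF p]] by (simp add: less_imp_le)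
          then show "(\<Sum>k<n. jac k p * h (S k p)) \<le> h p"
            using h_fixed[OF p] sum_le_suminf[of "\<lambda>k. jac k p * h (S k p)" "{..<n}"]
            by (simp add: sums_iff)
        qed
        finally show ?thesis
          using True by simp
      qed auto
    qed
  qed
  moreover have "(LINT p:A|lebesgue. (\<Sum>k<n. ?v k p)) = (\<Sum>k<n. LINT p:S k ` A|lebesgue. w p)" for n
    unfolding cv(2) unfolding set_lebesgue_integral_def scaleR_sum_right
    by (rule Bochner_Integration.integral_sum) (rule cv(1)[unfolded set_integrable_def])
  ultimately have "(\<lambda>k. LINT p:S k ` A|lebesgue. w p) sums (LINT p:A|lebesgue. w p)"
    by (simp add: sums_def)
  moreover have "(LINT p:(\<Union>k. S k ` A)|lebesgue. w p) = (\<Sum>k. LINT p:S k ` A|lebesgue. w p)"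
  proof (rule lebesgue_integral_countable_add)
    show "S k ` A \<in> sets lebesgue" for k
      using SA by auto
    show "S j ` A \<inter> S k ` A = {}" if "j \<noteq> k" for j k
      using disjoint_S[OF that] A by blast
    show "set_integrable lebesgue (\<Union>k. S k ` A) w"
      using SA by (intro int) auto
  qed
  ultimately show ?thesis
    using preimage_T[OF A(2)] by (simp add: sums_iff)
qed

text \<open>
  Invariance of the signed measure with density \<open>u\<close> shows that the part of the set outside its
  preimage is null, because \<open>u\<close> is positive there and nonpositive on the part of the preimage outside
  the set. The latter part may be a zero set of \<open>u\<close>, so that its nullity has to come from
  the positive density \<open>h\<close>.
\<close>
lemma null_or_conull_positive_set:
  assumes erg: "ergodic_on (lebesgue_on U) D T"
    and u: "continuous_on U u" and bound: "\<And>p. p \<in> U \<Longrightarrow> \<bar>u p\<bar> \<le> C * h p"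
    and fixed: "\<And>p. p \<in> U \<Longrightarrow> (\<lambda>k. jac k p * u (S k p)) sums u p"
  shows "negligible {p \<in> U. 0 < u p} \<or> negligible (U - {p \<in> U. 0 < u p})"
proof -
  define A where "A = {p \<in> U. 0 < u p}"
  define A' where "A' = {p \<in> D. T p \<in> A}"
  have "A = U \<inter> u -` {0<..}"
    by (auto simp: A_def)
  then have A: "open A" "A \<subseteq> U"
    using continuous_openin_preimage_gen[OF u open_greaterThan[of 0]] openin_open_eq[OF open_U]
    by (metis, blast)
  have A': "open A'" "A' \<subseteq> U"
    using A open_image_S[OF A] S_in_U by (auto simp: A'_def preimage_T)
  \<comment> \<open>Only integrability on \<open>X\<close> is available, hence the cut-off by the indicator function.\<close>
  have zero_int: "X \<in> null_sets lebesgue"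
    if "X \<in> sets lebesgue" "X \<subseteq> U" "(LINT p:X|lebesgue. v p) = 0"
      "set_integrable lebesgue X v" "\<And>p. p \<in> X \<Longrightarrow> 0 < v p" for X and v :: "real^'n::_ \<Rightarrow> real"
  proof (rule null_if_pos_func_has_zero_int[where f = "\<lambda>p. indicat_real X p *\<^sub>R v p"])
    show "integrable lebesgue (\<lambda>p. indicat_real X p *\<^sub>R v p)"
      using that by (simp add: set_integrable_def)
    show "(LINT p:X|lebesgue. indicat_real X p *\<^sub>R v p) = 0"
    proof -
      have "indicat_real X p *\<^sub>R (indicat_real X p *\<^sub>R v p) = indicat_real X p *\<^sub>R v p" for p
        by (simp add: indicator_def)
      then show ?thesis
        using that(3) by (simp only: set_lebesgue_integral_def)
    qed
  qed (use that in auto)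
  \<comment> \<open>The integrals over the intersection cancel.\<close>
  have split: "(LINT p:A|lebesgue. w p) - (LINT p:A'|lebesgue. w p)
      = (LINT p:A - A'|lebesgue. w p) - (LINT p:A' - A|lebesgue. w p)"
    if int_w: "\<And>X. X \<in> sets lebesgue \<Longrightarrow> X \<subseteq> U \<Longrightarrow> set_integrable lebesgue X w" for w :: "real^'n::_ \<Rightarrow> real"
  proof -
    have "(LINT p:X|lebesgue. w p) =
        (LINT p:X - Y|lebesgue. w p) + (LINT p:X \<inter> Y|lebesgue. w p)" 
      if "open X" "open Y" "X \<subseteq> U" for X Y
    proof -
      have "(LINT p:(X - Y) \<union> (X \<inter> Y)|lebesgue. w p) =
          (LINT p:X - Y|lebesgue. w p) + (LINT p:X \<inter> Y|lebesgue. w p)"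
        using that by (intro set_integral_Un int_w) auto
      moreover have "(X - Y) \<union> (X \<inter> Y) = X"
        by blast
      ultimately show ?thesis
        by simp
    qed
    from this[of A A'] this[of A' A] show ?thesis
      using A A' by (simp add: Int_commute)
  qed
  have [measurable]: "A \<in> sets lebesgue" "A' \<in> sets lebesgue"
    using A A' by auto
  have "A - A' \<in> null_sets lebesgue"
  proof (rule zero_int[where v = u])
    have int: "set_integrable lebesgue X u" if "X \<in> sets lebesgue" "X \<subseteq> U" for X
      by (rule integrable_dominated[OF u bound that])
    have "(LINT p:A|lebesgue. u p) - (LINT p:A'|lebesgue. u p) = 0"
      using integral_preimage_eq[OF u bound fixed A] by (simp add: A'_def)
    moreover have "0 \<le> (LINT p:A - A'|lebesgue. u p)"
      unfolding set_lebesgue_integral_def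
      by (rule Bochner_Integration.integral_nonneg) (auto simp: A_def indicator_def)
    moreover have "0 \<le> (LINT p:A' - A|lebesgue. - u p)"
      unfolding set_lebesgue_integral_def
      by (rule Bochner_Integration.integral_nonneg) (use A' in \<open>auto simp: A_def indicator_def\<close>)
    then have "(LINT p:A' - A|lebesgue. u p) \<le> 0"
      by (simp add: set_lebesgue_integral_def)
    ultimately show "(LINT p:A - A'|lebesgue. u p) = 0"
      using split[of u, OF int] by linarith
    show "set_integrable lebesgue (A - A') u"
      using A by (intro int) auto
  qed (use A in \<open>auto simp: A_def\<close>)
  moreover have "A' - A \<in> null_sets lebesgue"
  proof (rule zero_int[where v = h])
    have int: "set_integrable lebesgue X h" if "X \<in> sets lebesgue" "X \<subseteq> U" for X
      using that integrable_h set_integrable_subset by blast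
    have "(LINT p:A|lebesgue. h p) = (LINT p:A'|lebesgue. h p)"
      unfolding A'_def 
      by (rule integral_preimage_eq[OF continuous_h _ h_fixed A, of 1]) (auto dest: h_pos)
    moreover have "(LINT p:A - A'|lebesgue. h p) = 0"
      unfolding set_lebesgue_integral_def
      by (rule integral_eq_zero_AE)
        (use AE_not_in[OF \<open>A - A' \<in> null_sets lebesgue\<close>] in \<open>auto simp: indicator_def elim!: eventually_mono\<close>)
    ultimately show "(LINT p:A' - A|lebesgue. h p) = 0"
      using split[of h, OF int] by linarith
    show "set_integrable lebesgue (A' - A) h"
      using A' by (intro int) auto
  qed (use A' h_pos in \<open>auto\<close>)
  ultimately have sym_diff: "sym_diff A' A \<in> null_sets lebesgue"
    by auto
  have res: "X \<in> null_sets (lebesgue_on U) \<longleftrightarrow> X \<in> null_sets lebesgue" if "X \<subseteq> U" for X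
    using that open_U by (subst null_sets_restrict_space) auto
  have "A \<in> sets (lebesgue_on U)"
    using A open_U by (subst sets_restrict_space_iff) auto
  moreover have "sym_diff {p \<in> D. T p \<in> A} A \<in> null_sets (lebesgue_on U)"
    using sym_diff A A' by (subst res) (auto simp: A'_def)
  ultimately have "A \<in> null_sets (lebesgue_on U) \<or> space (lebesgue_on U) - A \<in> null_sets (lebesgue_on U)"
    using erg unfolding ergodic_on_def by blast
  then have "A \<in> null_sets lebesgue \<or> U - A \<in> null_sets lebesgue"
    using res[of A] res[of "U - A"] A(2) by simp
  then show ?thesis
    by (simp only: A_def negligible_iff_null_sets)
qed

text \<open>
  Only one inequality is needed: \<open>p\<close> and \<open>q\<close> are arbitrary, so exchanging them makes the ratio
  constant. The proof is pointwise because the two sets separated by the level \<open>c\<close> are open and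
  a nonempty open set is not null.
\<close>
lemma density_ratio_le:
  assumes erg: "ergodic_on (lebesgue_on U) D T"
    and f: "continuous_on U f" and bound: "\<And>p. p \<in> U \<Longrightarrow> \<bar>f p\<bar> \<le> C * h p"
    and fixed: "\<And>p. p \<in> U \<Longrightarrow> (\<lambda>k. jac k p * f (S k p)) sums f p"
    and pq: "p \<in> U" "q \<in> U"
  shows "f p / h p \<le> f q / h q"
proof (rule ccontr)
  assume "\<not> ?thesis"
  then obtain c where c: "f q / h q < c" "c < f p / h p"
    using dense by (meson not_le)
  define u where "u = (\<lambda>x. f x - c * h x)"
  have u: "continuous_on U u"
    unfolding u_def by (intro continuous_intros f continuous_h)
  have "\<bar>u x\<bar> \<le> (C + \<bar>c\<bar>) * h x" if "x \<in> U" for x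
  proof -
    have "\<bar>u x\<bar> \<le> \<bar>f x\<bar> + \<bar>c * h x\<bar>"
      by (simp add: u_def)
    then show ?thesis
      using bound[OF that] h_pos[OF that] by (simp add: abs_mult algebra_simps)
  qed
  moreover have "(\<lambda>k. jac k x * u (S k x)) sums u x" if "x \<in> U" for x
    using sums_diff[OF fixed[OF that] sums_mult[OF h_fixed[OF that], of c]]
    by (simp add: u_def algebra_simps)
  ultimately have null: "negligible {x \<in> U. 0 < u x} \<or> negligible (U - {x \<in> U. 0 < u x})"
    using null_or_conull_positive_set[OF erg u] by blast
  have "open (U \<inter> u -` X)" if "open X" for X
    using continuous_openin_preimage_gen[OF u that] by (simp only: openin_open_eq[OF open_U])
  then have "open (U \<inter> u -` {0<..})" "open (U \<inter> u -` {..<0})"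
    by simp_all
  moreover have "p \<in> U \<inter> u -` {0<..}" "q \<in> U \<inter> u -` {..<0}"
    using pq c h_pos[OF pq(1)] h_pos[OF pq(2)]
    by (simp_all add: u_def pos_less_divide_eq pos_divide_less_eq)
  ultimately have "\<not> negligible (U \<inter> u -` {0<..})" "\<not> negligible (U \<inter> u -` {..<0})"
    using open_not_negligible by blast+
  moreover have "U \<inter> u -` {0<..} \<subseteq> {x \<in> U. 0 < u x}" "U \<inter> u -` {..<0} \<subseteq> U - {x \<in> U. 0 < u x}"
    by auto
  ultimately show False
    using null negligible_subset by blast
qed

text \<open>
  The transfer operator is an unordered sum, with value 0 by convention unless the series
  converges absolutely. Domination by the series for \<open>h\<close> guarantees this convergence.
\<close>
lemma sums_if_fixed:
  assumes bound: "\<And>p. p \<in> U \<Longrightarrow> \<bar>f p\<bar> \<le> C * h p" 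
    and p: "p \<in> U"
  shows "(\<lambda>k. jac k p * f (S k p)) sums transfer_op D T f p"
proof -
  have "summable (\<lambda>k. norm (jac k p * f (S k p)))"
  proof (rule summable_comparison_test')
    show "summable (\<lambda>k. C * (jac k p * h (S k p)))"
      using h_fixed[OF p] by (simp add: sums_iff)
    show "norm (norm (jac k p * f (S k p))) \<le> C * (jac k p * h (S k p))" for k
      using bound[OF S_in_U[OF p], of k] jac_pos[OF p, of k] by (simp add: abs_mult mult.left_commute)
  qed
  then have "(\<lambda>k. jac k p * f (S k p)) summable_on UNIV"
    by (rule norm_summable_imp_summable_on)
  then show ?thesis
    unfolding transfer_op_eq[OF p] by (intro has_sum_imp_sums has_sum_infsum)
qed

theorem eigenspace_eq_span:
  assumes erg: "ergodic_on (lebesgue_on U) D T" and "U \<noteq> {}"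
    and V: "V = {f. continuous_on U f \<and> (\<forall>p. p \<notin> U \<longrightarrow> f p = 0) \<and> (\<exists>C. \<forall>p\<in>U. \<bar>f p\<bar> \<le> C * h p)}"
  shows "eigenspace (transfer_op D T) V 1 = range (\<lambda>c p. c * h p)"
proof (intro equalityI subsetI)
  fix f assume "f \<in> eigenspace (transfer_op D T) V 1"
  then have f: "continuous_on U f" "\<And>p. p \<notin> U \<Longrightarrow> f p = 0" and Lf: "transfer_op D T f = f"
    and "\<exists>C. \<forall>p\<in>U. \<bar>f p\<bar> \<le> C * h p"
    by (auto simp: eigenspace_def V)
  then obtain C where C: "\<And>p. p \<in> U \<Longrightarrow> \<bar>f p\<bar> \<le> C * h p"
    by blast
  have fixed: "(\<lambda>k. jac k p * f (S k p)) sums f p" if "p \<in> U" for p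
    using sums_if_fixed[OF C that] by (simp add: Lf)
  obtain q where q: "q \<in> U"
    using \<open>U \<noteq> {}\<close> by blast
  have "f p = f q / h q * h p" for p
  proof (cases "p \<in> U")
    case True
    then have "f p / h p = f q / h q"
      using density_ratio_le[OF erg f(1) C fixed] q by (simp add: order_antisym)
    then show ?thesis
      using h_pos[OF True] by (metis nonzero_eq_divide_eq less_irrefl)
  qed (simp add: f h_outside)
  then show "f \<in> range (\<lambda>c p. c * h p)"
    by blast
next
  fix f assume "f \<in> range (\<lambda>c p. c * h p)"
  then obtain c where f: "f = (\<lambda>p. c * h p)"
    by blast
  have bound: "\<bar>f p\<bar> \<le> \<bar>c\<bar> * h p" if "p \<in> U" for p
    using h_pos[OF that] by (simp add: f abs_mult)
  have "transfer_op D T f p = f p" for p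
  proof (cases "p \<in> U")
    case True
    have "(\<lambda>k. jac k p * f (S k p)) sums f p"
      using sums_mult[OF h_fixed[OF True], of c] by (simp add: f mult.left_commute)
    then show ?thesis
      using sums_if_fixed[OF bound True] sums_unique2 by blast
  qed (simp add: transfer_op_outside f h_outside)
  moreover have "continuous_on U f"
    unfolding f by (intro continuous_intros continuous_h)
  ultimately show "f \<in> eigenspace (transfer_op D T) V 1"
    using bound by (auto simp: eigenspace_def V f h_outside)
qed

corollary dim_eigenspace:
  assumes "ergodic_on (lebesgue_on U) D T" and "U \<noteq> {}"
    and "V = {f. continuous_on U f \<and> (\<forall>p. p \<notin> U \<longrightarrow> f p = 0) \<and> (\<exists>C. \<forall>p\<in>U. \<bar>f p\<bar> \<le> C * h p)}"
  shows "real_fun.dim (eigenspace (transfer_op D T) V 1) = 1"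
proof -
  obtain q where "q \<in> U"
    using \<open>U \<noteq> {}\<close> by blast
  then have "h q \<noteq> 0"
    using h_pos by force
  then have "h \<noteq> 0"
    by auto
  then have "real_fun.independent {h}"
    using real_fun.dependent_single by blast
  then have "real_fun.dim (real_fun.span {h}) = card {h}"
    by (rule real_fun.dim_span_eq_card_independent)
  moreover have "eigenspace (transfer_op D T) V 1 = real_fun.span {h}"
    unfolding eigenspace_eq_span[OF assms] by (rule real_fun.span_singleton[symmetric])
  ultimately show ?thesis
    by simp
qed

end

section \<open>Branches of triangle partition maps as projective maps\<close>

(* Permutation matrices are kept folded and evaluated only on vectors, by perm_mat_apply. *)
declare perm_mat.simps [simp del]

definition barycentric :: "real^2 \<Rightarrow> real^3" where
  "barycentric p = vector [1 - p$1, p$1 - p$2, p$2]"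

definition pos_cone :: "(real^3) set" where
  "pos_cone = {v. 0 < v$1 \<and> 0 < v$2 \<and> 0 < v$3}"

definition coord_sum :: "real^3 \<Rightarrow> real" where
  "coord_sum v = v$1 + v$2 + v$3"

text \<open>The branch with index \<open>k\<close> in barycentric coordinates, up to the normalising factor.\<close>
definition branch_mat :: "S3 \<Rightarrow> S3 \<Rightarrow> S3 \<Rightarrow> nat \<Rightarrow> real^3^3" where
  "branch_mat \<sigma> \<tau>0 \<tau>1 k = ((**) (mat_F1 \<sigma> \<tau>1) ^^ k) (mat_F0 \<sigma> \<tau>0)"

lemma perm_mat_apply:
  "perm_mat S3_e *v v = v"
  "perm_mat S3_12 *v v = vector [v$2, v$1, v$3]"
  "perm_mat S3_13 *v v = vector [v$3, v$2, v$1]"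
  "perm_mat S3_23 *v v = vector [v$1, v$3, v$2]"
  "perm_mat S3_123 *v v = vector [v$2, v$3, v$1]"
  "perm_mat S3_132 *v v = vector [v$3, v$1, v$2]"
  by (simp_all add: perm_mat.simps vec_eq_iff forall_3 matrix_vector_mult_def sum_3)

lemma mat_A0_apply: "mat_A0 *v v = vector [v$3, v$1, v$2 + v$3]"
  by (simp add: mat_A0_def vec_eq_iff forall_3 matrix_vector_mult_def sum_3)

lemma mat_A1_apply: "mat_A1 *v v = vector [v$1 + v$3, v$2, v$3]"
  by (simp add: mat_A1_def vec_eq_iff forall_3 matrix_vector_mult_def sum_3)

lemma mat_B_apply: "mat_B *v v = vector [v$1 + v$2 + v$3, v$2 + v$3, v$3]"
  by (simp add: mat_B_def vec_eq_iff forall_3 matrix_vector_mult_def sum_3)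

lemma det_perm_mat: "\<bar>det (perm_mat \<rho>)\<bar> = 1"
  by (cases \<rho>) (simp_all add: perm_mat.simps det_3)

lemma det_mat_A: "det mat_A0 = 1" "det mat_A1 = 1"
  by (simp_all add: det_3 mat_A0_def mat_A1_def)

lemma det_mat_B: "det mat_B = 1"
  by (simp add: det_3 mat_B_def)

lemma det_branch_mat: "\<bar>det (branch_mat \<sigma> \<tau>0 \<tau>1 k)\<bar> = 1"
  by (induction k)
    (simp_all add: branch_mat_def mat_F0_def mat_F1_def det_mul abs_mult det_perm_mat det_mat_A)

lemma matrix_vector_mult_cancel:
  fixes M :: "real^3^3"
  assumes "det M \<noteq> 0" "M *v v = M *v w"
  shows "v = w"
proof -
  obtain N where "N ** M = mat 1"
    using assms(1) invertible_det_nz[of M] unfolding invertible_def by blast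
  then show ?thesis
    using assms(2) by (metis matrix_vector_mul_assoc matrix_vector_mul_lid)
qed

lemma pos_cone_perm_mat: "v \<in> pos_cone \<Longrightarrow> perm_mat \<rho> *v v \<in> pos_cone"
  by (cases \<rho>) (auto simp: pos_cone_def perm_mat_apply)

lemma coord_sum_perm_mat: "coord_sum (perm_mat \<rho> *v v) = coord_sum v"
  by (cases \<rho>) (auto simp: coord_sum_def perm_mat_apply)

lemma pos_cone_mat_A: "v \<in> pos_cone \<Longrightarrow> mat_A0 *v v \<in> pos_cone" "v \<in> pos_cone \<Longrightarrow> mat_A1 *v v \<in> pos_cone"
  by (simp_all add: pos_cone_def mat_A0_apply mat_A1_apply)

lemma pos_cone_mat_F0: "v \<in> pos_cone \<Longrightarrow> mat_F0 \<sigma> \<tau>0 *v v \<in> pos_cone"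
  by (simp add: mat_F0_def matrix_vector_mul_assoc[symmetric] pos_cone_perm_mat pos_cone_mat_A)

lemma pos_cone_mat_F1: "v \<in> pos_cone \<Longrightarrow> mat_F1 \<sigma> \<tau>1 *v v \<in> pos_cone"
  by (simp add: mat_F1_def matrix_vector_mul_assoc[symmetric] pos_cone_perm_mat pos_cone_mat_A)

lemma branch_mat_0: "branch_mat \<sigma> \<tau>0 \<tau>1 0 = mat_F0 \<sigma> \<tau>0"
  by (simp add: branch_mat_def)

lemma branch_mat_Suc_apply:
  "branch_mat \<sigma> \<tau>0 \<tau>1 (Suc k) *v v = mat_F1 \<sigma> \<tau>1 *v (branch_mat \<sigma> \<tau>0 \<tau>1 k *v v)"
  by (simp add: branch_mat_def matrix_vector_mul_assoc)

lemma pos_cone_branch_mat: "v \<in> pos_cone \<Longrightarrow> branch_mat \<sigma> \<tau>0 \<tau>1 k *v v \<in> pos_cone"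
  by (induction k) (simp_all add: branch_mat_0 branch_mat_Suc_apply pos_cone_mat_F0 pos_cone_mat_F1)

text \<open>
  After cancelling \<open>\<sigma>\<close>, membership in the two image cones is decided by comparing the first and
  the third coordinate: \<open>A\<^sub>0\<close> makes the third one larger and \<open>A\<^sub>1\<close> the first one. This works for
  every triple, since permutations preserve the positive cone.
\<close>
lemma cone_images_disjoint:
  assumes "v \<in> pos_cone" "w \<in> pos_cone" "0 < c"
  shows "mat_F0 \<sigma> \<tau>0 *v v \<noteq> c *\<^sub>R (mat_F1 \<sigma> \<tau>1 *v w)"
proof
  assume "mat_F0 \<sigma> \<tau>0 *v v = c *\<^sub>R (mat_F1 \<sigma> \<tau>1 *v w)"
  then have "perm_mat \<sigma> *v (mat_A0 *v (perm_mat \<tau>0 *v v)) =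
      perm_mat \<sigma> *v (c *\<^sub>R (mat_A1 *v (perm_mat \<tau>1 *v w)))"
    by (simp add: mat_F0_def mat_F1_def matrix_vector_mul_assoc[symmetric] matrix_vector_mult_scaleR)
  moreover have "det (perm_mat \<sigma>) \<noteq> 0"
    using det_perm_mat[of \<sigma>] by auto
  ultimately have eq: "mat_A0 *v (perm_mat \<tau>0 *v v) = c *\<^sub>R (mat_A1 *v (perm_mat \<tau>1 *v w))"
    by (rule matrix_vector_mult_cancel[rotated])
  define v' w' where "v' = perm_mat \<tau>0 *v v" and "w' = perm_mat \<tau>1 *v w"
  have cone: "v' \<in> pos_cone" "w' \<in> pos_cone"
    using assms by (simp_all add: v'_def w'_def pos_cone_perm_mat)
  have "v'$3 = c * (w'$1 + w'$3)" "v'$2 + v'$3 = c * w'$3"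
    using eq by (simp_all add: v'_def[symmetric] w'_def[symmetric] mat_A0_apply mat_A1_apply
        vec_eq_iff forall_3)
  then have "v'$2 + c * w'$1 = 0"
    by (simp add: algebra_simps)
  then show False
    using cone \<open>0 < c\<close> by (simp add: pos_cone_def) (smt (verit) mult_pos_pos)
qed

text \<open>
  Cancelling the common power \<open>F\<^sub>1\<^sup>j\<close> reduces disjointness of two branches to that of the images of \<open>F\<^sub>0\<close>
  and \<open>F\<^sub>1\<close>; the factor \<open>c\<close> is there because the branches only see rays of the cone.
\<close>
lemma branch_cones_disjoint:
  assumes "v \<in> pos_cone" "w \<in> pos_cone" "0 < c"
  shows "branch_mat \<sigma> \<tau>0 \<tau>1 j *v v \<noteq> c *\<^sub>R (branch_mat \<sigma> \<tau>0 \<tau>1 (j + Suc m) *v w)"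
proof (induction j)
  case 0
  show ?case
    using cone_images_disjoint[OF assms(1) pos_cone_branch_mat[OF assms(2)] assms(3)]
    by (simp add: branch_mat_0 branch_mat_Suc_apply)
next
  case (Suc j)
  have "det (mat_F1 \<sigma> \<tau>1) \<noteq> 0"
    using det_perm_mat[of \<sigma>] det_perm_mat[of \<tau>1] by (auto simp: mat_F1_def det_mul det_mat_A)
  from matrix_vector_mult_cancel[OF this] Suc show ?case
    unfolding add_Suc branch_mat_Suc_apply matrix_vector_mult_scaleR[symmetric] by blast
qed

lemma barycentric_in_pos_cone: "barycentric p \<in> pos_cone \<longleftrightarrow> p \<in> open_triangle"
  by (auto simp: barycentric_def pos_cone_def open_triangle_def)

lemma coord_sum_barycentric: "coord_sum (barycentric p) = 1"
  by (simp add: barycentric_def coord_sum_def)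

lemma coord_sum_pos: "v \<in> pos_cone \<Longrightarrow> 0 < coord_sum v"
  by (simp add: coord_sum_def pos_cone_def)

lemma barycentric_inject: "barycentric p = barycentric q \<Longrightarrow> p = q"
  by (auto simp: barycentric_def vec_eq_iff forall_2 forall_3)

lemma mat_B_inverse: "mat_B ** matrix_inv mat_B = mat 1" "matrix_inv mat_B ** mat_B = mat 1"
proof -
  have "\<exists>N. mat_B ** N = mat 1 \<and> N ** mat_B = mat 1"
    using det_mat_B invertible_det_nz[of mat_B] unfolding invertible_def by simp
  then show "mat_B ** matrix_inv mat_B = mat 1" "matrix_inv mat_B ** mat_B = mat 1"
    unfolding matrix_inv_def by (rule someI2_ex; blast)+
qed

lemma matrix_inv_mat_B: "matrix_inv mat_B *v vector [1, p$1, p$2] = barycentric p"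
proof -
  have "vector [1, p$1, p$2] = mat_B *v barycentric p"
    by (simp add: mat_B_apply barycentric_def)
  then show ?thesis
    by (simp add: matrix_vector_mul_assoc mat_B_inverse)
qed

lemma branch_vec_eq: "branch_vec \<sigma> \<tau>0 \<tau>1 k p = mat_B *v (branch_mat \<sigma> \<tau>0 \<tau>1 k *v barycentric p)"
  unfolding branch_vec_def branch_mat_def[symmetric]
  by (simp add: matrix_vector_mul_assoc[symmetric] matrix_inv_mat_B)

text \<open>
  This is the denominator \<open>d\<^sub>k\<close>: the first row of \<open>B\<close> sums the coordinates.
\<close>
definition branch_denom :: "S3 \<Rightarrow> S3 \<Rightarrow> S3 \<Rightarrow> nat \<Rightarrow> real^2 \<Rightarrow> real" where
  "branch_denom \<sigma> \<tau>0 \<tau>1 k p = coord_sum (branch_mat \<sigma> \<tau>0 \<tau>1 k *v barycentric p)"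

lemma branch_denom_pos: "p \<in> open_triangle \<Longrightarrow> 0 < branch_denom \<sigma> \<tau>0 \<tau>1 k p"
  by (simp add: branch_denom_def barycentric_in_pos_cone coord_sum_pos pos_cone_branch_mat)

lemma barycentric_branch:
  assumes "p \<in> open_triangle"
  shows "barycentric (branch \<sigma> \<tau>0 \<tau>1 k p) =
    (1 / branch_denom \<sigma> \<tau>0 \<tau>1 k p) *\<^sub>R (branch_mat \<sigma> \<tau>0 \<tau>1 k *v barycentric p)"
proof -
  define v where "v = branch_mat \<sigma> \<tau>0 \<tau>1 k *v barycentric p"
  define d where "d = branch_denom \<sigma> \<tau>0 \<tau>1 k p"
  have d: "d = v$1 + v$2 + v$3" "d \<noteq> 0"
    using branch_denom_pos[OF assms, of \<sigma> \<tau>0 \<tau>1 k]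
    by (simp_all add: d_def v_def branch_denom_def coord_sum_def)
  then have "branch \<sigma> \<tau>0 \<tau>1 k p = vector [(v$2 + v$3) / d, v$3 / d]"
    by (simp add: branch_def Let_def branch_vec_eq mat_B_apply v_def)
  moreover have "1 - (v$2 + v$3) / d = v$1 / d"
    using d by (simp add: field_simps)
  ultimately show ?thesis
    unfolding v_def[symmetric] d_def[symmetric]
    by (simp add: barycentric_def vec_eq_iff forall_3 diff_divide_distrib[symmetric])
qed

lemma branch_in_triangle: "p \<in> open_triangle \<Longrightarrow> branch \<sigma> \<tau>0 \<tau>1 k p \<in> open_triangle"
  using branch_denom_pos[of p \<sigma> \<tau>0 \<tau>1 k] pos_cone_branch_mat[of "barycentric p" \<sigma> \<tau>0 \<tau>1 k]
  by (simp add: barycentric_in_pos_cone[symmetric] barycentric_branch)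
    (simp add: pos_cone_def)

lemma branch_eq_imp:
  assumes "p \<in> open_triangle" "q \<in> open_triangle" "branch \<sigma> \<tau>0 \<tau>1 j p = branch \<sigma> \<tau>0 \<tau>1 k q"
  obtains c where "0 < c"
    "branch_mat \<sigma> \<tau>0 \<tau>1 j *v barycentric p = c *\<^sub>R (branch_mat \<sigma> \<tau>0 \<tau>1 k *v barycentric q)"
proof
  let ?dp = "branch_denom \<sigma> \<tau>0 \<tau>1 j p" and ?dq = "branch_denom \<sigma> \<tau>0 \<tau>1 k q"
  have pos: "0 < ?dp" "0 < ?dq"
    using assms branch_denom_pos by auto
  then show "0 < ?dp / ?dq"
    by simp
  have "(1 / ?dp) *\<^sub>R (branch_mat \<sigma> \<tau>0 \<tau>1 j *v barycentric p) =
      (1 / ?dq) *\<^sub>R (branch_mat \<sigma> \<tau>0 \<tau>1 k *v barycentric q)"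
    using assms barycentric_branch by metis
  then have "?dp *\<^sub>R ((1 / ?dp) *\<^sub>R (branch_mat \<sigma> \<tau>0 \<tau>1 j *v barycentric p)) =
      ?dp *\<^sub>R ((1 / ?dq) *\<^sub>R (branch_mat \<sigma> \<tau>0 \<tau>1 k *v barycentric q))"
    by (rule arg_cong)
  then show "branch_mat \<sigma> \<tau>0 \<tau>1 j *v barycentric p = (?dp / ?dq) *\<^sub>R (branch_mat \<sigma> \<tau>0 \<tau>1 k *v barycentric q)"
    using pos by simp
qed

lemma inj_on_branch: "inj_on (branch \<sigma> \<tau>0 \<tau>1 k) open_triangle"
proof (rule inj_onI)
  fix p q assume "p \<in> open_triangle" "q \<in> open_triangle" "branch \<sigma> \<tau>0 \<tau>1 k p = branch \<sigma> \<tau>0 \<tau>1 k q"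
  then obtain c where
    "branch_mat \<sigma> \<tau>0 \<tau>1 k *v barycentric p = c *\<^sub>R (branch_mat \<sigma> \<tau>0 \<tau>1 k *v barycentric q)"
    by (rule branch_eq_imp)
  then have "branch_mat \<sigma> \<tau>0 \<tau>1 k *v barycentric p = branch_mat \<sigma> \<tau>0 \<tau>1 k *v (c *\<^sub>R barycentric q)"
    by (simp add: matrix_vector_mult_scaleR)
  moreover have "det (branch_mat \<sigma> \<tau>0 \<tau>1 k) \<noteq> 0"
    using det_branch_mat[of \<sigma> \<tau>0 \<tau>1 k] by auto
  ultimately have eq: "barycentric p = c *\<^sub>R barycentric q"
    by (rule matrix_vector_mult_cancel[rotated])
  then have "coord_sum (barycentric p) = c * coord_sum (barycentric q)"
    by (simp add: coord_sum_def algebra_simps)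
  then have "c = 1"
    unfolding coord_sum_barycentric by simp
  then show "p = q"
    using eq by (simp add: barycentric_inject)
qed

lemma branches_disjoint:
  assumes "j \<noteq> k"
  shows "branch \<sigma> \<tau>0 \<tau>1 j ` open_triangle \<inter> branch \<sigma> \<tau>0 \<tau>1 k ` open_triangle = {}"
proof -
  have no_overlap: False
    if pq: "p \<in> open_triangle" "q \<in> open_triangle" and eq: "branch \<sigma> \<tau>0 \<tau>1 i p = branch \<sigma> \<tau>0 \<tau>1 l q"
      and "i < l" for p q i l
  proof -
    obtain m where l: "l = i + Suc m"
      using \<open>i < l\<close> less_iff_Suc_add by auto
    obtain c where "0 < c"
      "branch_mat \<sigma> \<tau>0 \<tau>1 i *v barycentric p = c *\<^sub>R (branch_mat \<sigma> \<tau>0 \<tau>1 l *v barycentric q)"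
      using branch_eq_imp[OF pq eq] by blast
    moreover have "barycentric p \<in> pos_cone" "barycentric q \<in> pos_cone"
      using pq by (simp_all add: barycentric_in_pos_cone)
    ultimately show False
      unfolding l using branch_cones_disjoint by blast
  qed
  show ?thesis
  proof (rule equals0I)
    fix x assume "x \<in> branch \<sigma> \<tau>0 \<tau>1 j ` open_triangle \<inter> branch \<sigma> \<tau>0 \<tau>1 k ` open_triangle"
    then obtain p q where pq: "p \<in> open_triangle" "q \<in> open_triangle"
      and eq: "branch \<sigma> \<tau>0 \<tau>1 j p = branch \<sigma> \<tau>0 \<tau>1 k q"
      by (metis IntE imageE)
    from assms consider "j < k" | "k < j"
      by linarith
    then show False
      using no_overlap[OF pq eq] no_overlap[OF pq(2,1) eq[symmetric]] by cases
  qed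
qed

lemma tpm_branch:
  assumes p: "p \<in> open_triangle"
  shows "tpm \<sigma> \<tau>0 \<tau>1 (branch \<sigma> \<tau>0 \<tau>1 k p) = p"
proof -
  have "(THE j. branch \<sigma> \<tau>0 \<tau>1 k p \<in> subtriangle \<sigma> \<tau>0 \<tau>1 j) = k"
    unfolding subtriangle_def
  proof (rule the_equality)
    show "branch \<sigma> \<tau>0 \<tau>1 k p \<in> branch \<sigma> \<tau>0 \<tau>1 k ` open_triangle"
      using p by (rule imageI)
    then show "j = k" if "branch \<sigma> \<tau>0 \<tau>1 k p \<in> branch \<sigma> \<tau>0 \<tau>1 j ` open_triangle" for j
      using branches_disjoint[of j k \<sigma> \<tau>0 \<tau>1] that by blast
  qed
  then show ?thesis
    using p by (simp add: tpm_def the_inv_into_f_f inj_on_branch)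
qed

lemma open_open_triangle: "open open_triangle"
  unfolding open_triangle_def
  by (intro open_Collect_conj open_Collect_less continuous_intros)

section \<open>The Jacobian of a projective map\<close>

definition projective_map :: "real^3^3 \<Rightarrow> real^2 \<Rightarrow> real^2" where
  "projective_map N p = (let v = N *v vector [1, p$1, p$2] in vector [v$2 / v$1, v$3 / v$1])"

definition projective_deriv :: "real^3^3 \<Rightarrow> real^2 \<Rightarrow> real^2 \<Rightarrow> real^2" where
  "projective_deriv N p q =
    (let v = N *v vector [1, p$1, p$2]; w = N *v vector [0, q$1, q$2]
     in vector [(w$2 * v$1 - v$2 * w$1) / (v$1)\<^sup>2, (w$3 * v$1 - v$3 * w$1) / (v$1)\<^sup>2])"

lemma has_derivative_vector_2:
  assumes "(f has_derivative f') F" "(g has_derivative g') F"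
  shows "((\<lambda>p. vector [f p, g p] :: real^2) has_derivative (\<lambda>q. vector [f' q, g' q])) F"
proof -
  have vec: "(vector [a, b] :: real^2) = a *\<^sub>R axis 1 1 + b *\<^sub>R axis 2 1" for a b
    by (simp add: vec_eq_iff forall_2 axis_def)
  show ?thesis
    unfolding vec by (intro has_derivative_add has_derivative_scaleR_left assms)
qed

lemma projective_map_has_derivative:
  assumes "(N *v vector [1, p$1, p$2])$1 \<noteq> 0"
  shows "(projective_map N has_derivative projective_deriv N p) (at p)"
proof -
  have nth: "((\<lambda>p. p$j) has_derivative (\<lambda>q. q$j)) (at p)" for j and p :: "real^2"
    by (rule bounded_linear_imp_has_derivative[OF bounded_linear_vec_nth])
  have coord: "((\<lambda>p. (N *v vector [1, p$1, p$2])$i) has_derivative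
      (\<lambda>q. (N *v vector [0, q$1, q$2])$i)) (at p)" for i
    by (auto simp: matrix_vector_mult_def sum_3 intro!: derivative_eq_intros nth)
  show ?thesis
    unfolding projective_map_def projective_deriv_def Let_def
    by (rule has_derivative_vector_2; rule has_derivative_eq_rhs[OF has_derivative_divide'[OF coord coord assms]])
      (simp_all add: fun_eq_iff power2_eq_square)
qed

text \<open>
  The determinant is \<open>1 / d\<^sup>3\<close> times that of \<open>N\<close> with its first column replaced by \<open>N (1, x, y)\<close>, and this
  column operation does not change the determinant.
\<close>
lemma det_projective_deriv:
  assumes "(N *v vector [1, p$1, p$2])$1 \<noteq> 0"
  shows "det (matrix (projective_deriv N p)) = det N / ((N *v vector [1, p$1, p$2])$1) ^ 3"
proof -
  let ?v = "N *v vector [1, p$1, p$2]"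
  define d a b where "d = ?v$1" and "a = ?v$2" and "b = ?v$3"
  have d: "d \<noteq> 0"
    using assms by (simp add: d_def)
  have "det (matrix (projective_deriv N p)) =
      (N$2$2 * d - a * N$1$2) / d\<^sup>2 * ((N$3$3 * d - b * N$1$3) / d\<^sup>2) -
      (N$2$3 * d - a * N$1$3) / d\<^sup>2 * ((N$3$2 * d - b * N$1$2) / d\<^sup>2)"
    by (simp add: det_2 matrix_def projective_deriv_def Let_def axis_def d_def[symmetric]
        a_def[symmetric] b_def[symmetric]) (simp add: matrix_vector_mult_def sum_3)
  also have "\<dots> = d * (d * (N$2$2 * N$3$3 - N$2$3 * N$3$2) - a * (N$1$2 * N$3$3 - N$1$3 * N$3$2)
      + b * (N$1$2 * N$2$3 - N$1$3 * N$2$2)) / d ^ 4"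
  proof -
    have "x / d\<^sup>2 * (y / d\<^sup>2) - z / d\<^sup>2 * (w / d\<^sup>2) = (x * y - z * w) / d ^ 4" for x y z w
      by (simp add: diff_divide_distrib flip: power_add)
    then show ?thesis
      by (simp only:) (simp add: algebra_simps)
  qed
  also have "d * (N$2$2 * N$3$3 - N$2$3 * N$3$2) - a * (N$1$2 * N$3$3 - N$1$3 * N$3$2)
      + b * (N$1$2 * N$2$3 - N$1$3 * N$2$2) = det N"
    by (simp add: d_def a_def b_def matrix_vector_mult_def sum_3 det_3) (simp add: algebra_simps)
  also have "d * det N / d ^ 4 = det N / d ^ 3"
    using d by (simp add: eval_nat_numeral)
  finally show ?thesis
    by (simp add: d_def)
qed

text \<open>The matrix of the branch in the homogeneous coordinates \<open>(1, x, y)\<close>.\<close>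
definition hom_branch_mat :: "S3 \<Rightarrow> S3 \<Rightarrow> S3 \<Rightarrow> nat \<Rightarrow> real^3^3" where
  "hom_branch_mat \<sigma> \<tau>0 \<tau>1 k = mat_B ** branch_mat \<sigma> \<tau>0 \<tau>1 k ** matrix_inv mat_B"

lemma branch_eq_projective_map: "branch \<sigma> \<tau>0 \<tau>1 k = projective_map (hom_branch_mat \<sigma> \<tau>0 \<tau>1 k)"
  by (simp add: fun_eq_iff branch_def projective_map_def branch_vec_def hom_branch_mat_def branch_mat_def)

lemma hom_branch_mat_1:
  "(hom_branch_mat \<sigma> \<tau>0 \<tau>1 k *v vector [1, p$1, p$2])$1 = branch_denom \<sigma> \<tau>0 \<tau>1 k p"
  by (simp add: hom_branch_mat_def matrix_vector_mul_assoc[symmetric] matrix_inv_mat_B mat_B_apply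
      branch_denom_def coord_sum_def)

lemma det_hom_branch_mat: "\<bar>det (hom_branch_mat \<sigma> \<tau>0 \<tau>1 k)\<bar> = 1"
proof -
  have "det mat_B * det (matrix_inv mat_B) = 1"
    by (metis det_I det_mul mat_B_inverse(1))
  then show ?thesis
    by (simp add: hom_branch_mat_def det_mul abs_mult det_mat_B det_branch_mat)
qed

lemma full_branch_map_tpm:
  "full_branch_map open_triangle (branch \<sigma> \<tau>0 \<tau>1)
     (\<lambda>k. projective_deriv (hom_branch_mat \<sigma> \<tau>0 \<tau>1 k)) (tpm_dom \<sigma> \<tau>0 \<tau>1) (tpm \<sigma> \<tau>0 \<tau>1)"
proof
  show "open open_triangle"
    by (rule open_open_triangle)
  show "inj_on (branch \<sigma> \<tau>0 \<tau>1 k) open_triangle" for k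
    by (rule inj_on_branch)
  show "branch \<sigma> \<tau>0 \<tau>1 j ` open_triangle \<inter> branch \<sigma> \<tau>0 \<tau>1 k ` open_triangle = {}" if "j \<noteq> k" for j k
    using that by (rule branches_disjoint)
  show "tpm_dom \<sigma> \<tau>0 \<tau>1 = (\<Union>k. branch \<sigma> \<tau>0 \<tau>1 k ` open_triangle)"
    by (simp add: tpm_dom_def subtriangle_def)
  fix p k assume p: "p \<in> open_triangle"
  have denom: "(hom_branch_mat \<sigma> \<tau>0 \<tau>1 k *v vector [1, p$1, p$2])$1 \<noteq> 0"
    using branch_denom_pos[OF p, of \<sigma> \<tau>0 \<tau>1 k] by (simp add: hom_branch_mat_1)
  show "branch \<sigma> \<tau>0 \<tau>1 k p \<in> open_triangle"
    using p by (rule branch_in_triangle)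
  show "(branch \<sigma> \<tau>0 \<tau>1 k has_derivative projective_deriv (hom_branch_mat \<sigma> \<tau>0 \<tau>1 k) p) (at p)"
    unfolding branch_eq_projective_map using denom by (rule projective_map_has_derivative)
  show "det (matrix (projective_deriv (hom_branch_mat \<sigma> \<tau>0 \<tau>1 k) p)) \<noteq> 0"
    using denom det_hom_branch_mat[of \<sigma> \<tau>0 \<tau>1 k] by (auto simp: det_projective_deriv)
  show "tpm \<sigma> \<tau>0 \<tau>1 (branch \<sigma> \<tau>0 \<tau>1 k p) = p"
    using p by (rule tpm_branch)
qed

text \<open>
  All the matrices that make up a branch have determinant \<open>\<plusminus>1\<close>, so only the power of the denominator is left.
\<close>
lemma jac_tpm:
  assumes p: "p \<in> open_triangle"
  shows "full_branch_map.jac (\<lambda>k. projective_deriv (hom_branch_mat \<sigma> \<tau>0 \<tau>1 k)) k p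
    = 1 / branch_denom \<sigma> \<tau>0 \<tau>1 k p ^ 3"
  using branch_denom_pos[OF p, of \<sigma> \<tau>0 \<tau>1 k] det_hom_branch_mat[of \<sigma> \<tau>0 \<tau>1 k]
  by (simp add: full_branch_map.jac_def[OF full_branch_map_tpm] det_projective_deriv hom_branch_mat_1)

section \<open>Fixed densities on the positive cone\<close>

text \<open>
  For the triples \<open>(e, \<kappa>, e)\<close> the value at \<open>v = (1 - x, x - y, y)\<close> is \<open>1 / (x (1 + y))\<close> when \<open>\<kappa> = e\<close>
  and \<open>1 / (x (1 - y))\<close> otherwise; the factors \<open>coord_sum v\<close>, equal to 1 there, make the function homogeneous
  of degree \<open>-3\<close>.
\<close>
definition cone_density :: "S3 \<Rightarrow> real^3 \<Rightarrow> real" where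
  "cone_density \<kappa> v = 1 / (coord_sum v * (v$2 + v$3) *
     (if \<kappa> = S3_e then coord_sum v + v$3 else v$1 + v$2))"

lemma cone_density_pos: "v \<in> pos_cone \<Longrightarrow> 0 < cone_density \<kappa> v"
  by (simp add: cone_density_def pos_cone_def coord_sum_def)

lemma cone_density_scale: "0 < c \<Longrightarrow> cone_density \<kappa> (c *\<^sub>R v) = cone_density \<kappa> v / c ^ 3"
  by (simp add: cone_density_def coord_sum_def power3_eq_cube flip: distrib_left)

lemma telescoping_sum:
  fixes a b :: real
  assumes "0 < a" "0 < b"
  shows "(\<lambda>k. b / ((a + real k * b) * (a + real (Suc k) * b))) sums (1 / a)"
proof -
  have "filterlim (\<lambda>k. a + real k * b) at_top sequentially"
    using assms
    by (intro filterlim_tendsto_add_at_top[OF tendsto_const]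
        filterlim_at_top_mult_tendsto_pos[OF tendsto_const] filterlim_real_sequentially)
  then have "(\<lambda>k. 1 / (a + real k * b)) \<longlonglongrightarrow> 0"
    by (intro tendsto_divide_0[OF tendsto_const] filterlim_at_top_imp_at_infinity)
  from telescope_sums'[OF this]
  have "(\<lambda>k. 1 / (a + real k * b) - 1 / (a + real (Suc k) * b)) sums (1 / a)"
    by simp
  moreover have "1 / (a + real k * b) - 1 / (a + real (Suc k) * b)
      = b / ((a + real k * b) * (a + real (Suc k) * b))" for k
  proof -
    have "a + real k * b > 0" "a + real (Suc k) * b > 0"
      using assms by (simp_all add: add_pos_nonneg)
    then have "1 / (a + real k * b) - 1 / (a + real (Suc k) * b)
        = ((a + real (Suc k) * b) - (a + real k * b)) / ((a + real k * b) * (a + real (Suc k) * b))"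
      by (subst diff_frac_eq) (auto simp: mult_ac)
    then show ?thesis
      by (simp add: algebra_simps)
  qed
  ultimately show ?thesis
    by simp
qed

text \<open>
  Along the orbit only the first coordinate moves, in steps of \<open>w$3\<close>. Two of the three factors in the
  denominator are therefore consecutive terms of an arithmetic progression starting at \<open>a\<close>,
  and the remaining factor is constant.
\<close>
lemma cone_density_fixed:
  assumes \<kappa>: "\<kappa> \<in> {S3_e, S3_23, S3_132}"
    and v: "v \<in> pos_cone"
  defines "w \<equiv> mat_A0 *v (perm_mat \<kappa> *v v)"
  shows "(\<lambda>k. cone_density \<kappa> (vector [w$1 + real k * w$3, w$2, w$3])) sums cone_density \<kappa> v"
proof -
  have w: "0 < w$1" "0 < w$2" "0 < w$3"
    using pos_cone_mat_A(1)[OF pos_cone_perm_mat[OF v, of \<kappa>]] by (simp_all add: w_def pos_cone_def)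
  define a where "a = (if \<kappa> = S3_e then w$1 + w$2 + w$3 else w$1 + w$2)"
  have "0 < a"
    using w by (simp add: a_def)
  have "cone_density \<kappa> (vector [w$1 + real k * w$3, w$2, w$3]) =
      1 / ((w$2 + w$3) * w$3) * (w$3 / ((a + real k * w$3) * (a + real (Suc k) * w$3)))" for k
  proof -
    let ?u = "vector [w$1 + real k * w$3, w$2, w$3] :: real^3"
    have "coord_sum ?u * (if \<kappa> = S3_e then coord_sum ?u + ?u$3 else ?u$1 + ?u$2) =
        (a + real k * w$3) * (a + real (Suc k) * w$3)"
    proof (cases "\<kappa> = S3_e")
      case True
      then have "coord_sum ?u = a + real k * w$3" "coord_sum ?u + ?u$3 = a + real (Suc k) * w$3"
        by (simp_all add: coord_sum_def a_def algebra_simps)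
      then show ?thesis
        using True by simp
    next
      case False
      then have "?u$1 + ?u$2 = a + real k * w$3" "coord_sum ?u = a + real (Suc k) * w$3"
        by (simp_all add: coord_sum_def a_def algebra_simps)
      then show ?thesis
        using False by simp
    qed
    then have "cone_density \<kappa> ?u = 1 / ((w$2 + w$3) * ((a + real k * w$3) * (a + real (Suc k) * w$3)))"
      by (simp only: cone_density_def mult.commute[of "coord_sum ?u"] mult.assoc) simp
    then show ?thesis
      using w by simp
  qed
  moreover have "cone_density \<kappa> v = 1 / ((w$2 + w$3) * w$3) * (1 / a)"
    using \<kappa> by (auto simp: cone_density_def coord_sum_def a_def w_def perm_mat_apply mat_A0_apply algebra_simps)
  ultimately show ?thesis
    using sums_mult[OF telescoping_sum[OF \<open>0 < a\<close> w(3)], of "1 / ((w$2 + w$3) * w$3)"] by simp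
qed

text \<open>
  When \<open>\<tau>\<^sub>1\<close> is the inverse of \<open>\<sigma>\<close>, conjugation by \<open>\<sigma>\<close> turns \<open>F\<^sub>1\<close> into \<open>A\<^sub>1\<close> and \<open>F\<^sub>0\<close> into \<open>A\<^sub>0 \<kappa>\<close>
  with \<open>\<kappa> = \<tau>\<^sub>0 \<sigma>\<close>. One computation thus serves all six conjugates of \<open>(e, \<kappa>, e)\<close>.
\<close>
lemma branch_mat_conj:
  assumes \<sigma>\<tau>1: "\<And>v. perm_mat \<tau>1 *v (perm_mat \<sigma> *v v) = v"
    and \<kappa>: "\<And>v. perm_mat \<tau>0 *v v = perm_mat \<kappa> *v (perm_mat \<tau>1 *v v)"
  defines "w \<equiv> \<lambda>v. mat_A0 *v (perm_mat \<kappa> *v (perm_mat \<tau>1 *v v))"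
  shows "perm_mat \<tau>1 *v (branch_mat \<sigma> \<tau>0 \<tau>1 k *v v) = vector [w v$1 + real k * w v$3, w v$2, w v$3]"
proof (induction k)
  case 0
  show ?case
    by (simp add: branch_mat_0 mat_F0_def matrix_vector_mul_assoc[symmetric] \<sigma>\<tau>1 \<kappa>)
      (simp add: w_def vec_eq_iff forall_3)
next
  case (Suc k)
  have "perm_mat \<tau>1 *v (branch_mat \<sigma> \<tau>0 \<tau>1 (Suc k) *v v) =
      mat_A1 *v (perm_mat \<tau>1 *v (branch_mat \<sigma> \<tau>0 \<tau>1 k *v v))"
    by (simp add: branch_mat_Suc_apply mat_F1_def matrix_vector_mul_assoc[symmetric] \<sigma>\<tau>1)
  then show ?case
    by (simp add: Suc mat_A1_apply algebra_simps)
qed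

section \<open>Integrability of the densities\<close>

text \<open>
  A singularity of type \<open>1 / r\<close> at a vertex disappears in the polar-type coordinates \<open>q\<close> with
  \<open>s = q$1\<close> and \<open>t = q$1 * q$2\<close>: they map the unit square onto the triangle with Jacobian \<open>q$1\<close>, which cancels
  the singularity. Here \<open>(s, t)\<close> are affine coordinates whose origin \<open>(c1, c2)\<close> is the vertex, with \<open>s\<close>
  equal to 1 on the opposite edge.
\<close>
lemma integrable_inverse_affine_coordinate:
  fixes s t :: "real^2 \<Rightarrow> real"
  assumes det: "\<bar>a1 * b2 - a2 * b1\<bar> = 1"
    and coords: "\<And>p u v. p$1 = c1 + u * a1 + v * b1 \<and> p$2 = c2 + u * a2 + v * b2 \<longleftrightarrow> s p = u \<and> t p = v"
    and triangle: "\<And>p. p \<in> open_triangle \<longleftrightarrow> 0 < t p \<and> t p < s p \<and> s p < 1"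
  shows "set_integrable lebesgue open_triangle (\<lambda>p. 1 / s p)"
proof -
  define Q :: "(real^2) set" where "Q = box 0 1"
  have Q: "q \<in> Q \<longleftrightarrow> 0 < q$1 \<and> q$1 < 1 \<and> 0 < q$2 \<and> q$2 < 1" for q
    by (auto simp: Q_def mem_box_cart forall_2)
  define g :: "real^2 \<Rightarrow> real^2" where
    "g = (\<lambda>q. vector [c1 + q$1 * a1 + (q$1 * q$2) * b1, c2 + q$1 * a2 + (q$1 * q$2) * b2])"
  define g' :: "real^2 \<Rightarrow> real^2 \<Rightarrow> real^2" where
    "g' = (\<lambda>q r. vector [r$1 * a1 + (q$1 * r$2 + r$1 * q$2) * b1, r$1 * a2 + (q$1 * r$2 + r$1 * q$2) * b2])"
  have st: "s (g q) = q$1" "t (g q) = q$1 * q$2" for q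
    using coords[of "g q" "q$1" "q$1 * q$2"] by (simp_all add: g_def)
  have nth: "((\<lambda>q. q$j) has_derivative (\<lambda>r. r$j)) (at q within A)" for j and q :: "real^2" and A
    by (rule bounded_linear_imp_has_derivative[OF bounded_linear_vec_nth])
  have der: "(g has_derivative g' q) (at q within Q)" for q
    unfolding g_def g'_def
    by (rule has_derivative_vector_2) (auto intro!: derivative_eq_intros nth)
  have inj: "inj_on g Q"
  proof (rule inj_onI)
    fix q r assume q: "q \<in> Q" and eq: "g q = g r"
    have "q$1 = r$1" "q$1 * q$2 = r$1 * r$2"
      using st[of q] st[of r] unfolding eq by metis+
    then show "q = r"
      using q by (auto simp: Q vec_eq_iff forall_2)
  qed
  have image: "g ` Q = open_triangle"
  proof (intro equalityI subsetI)
    fix p assume "p \<in> g ` Q"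
    then show "p \<in> open_triangle"
      by (auto simp: triangle st Q)
  next
    fix p assume p: "p \<in> open_triangle"
    let ?q = "vector [s p, t p / s p] :: real^2"
    have "g ?q = p"
      using p coords[of p "s p" "t p"] by (simp add: triangle g_def vec_eq_iff forall_2)
    moreover have "?q \<in> Q"
      using p by (simp add: triangle Q)
    ultimately show "p \<in> g ` Q"
      by (metis imageI)
  qed
  have pullback: "\<bar>det (matrix (g' q))\<bar> * (1 / s (g q)) = 1" if q: "q \<in> Q" for q
  proof -
    have "det (matrix (g' q)) = q$1 * (a1 * b2 - a2 * b1)"
      by (simp add: g'_def det_2 matrix_def axis_def algebra_simps)
    then show ?thesis
      using q det by (simp add: abs_mult st Q)
  qed
  have "set_integrable lebesgue Q (\<lambda>q. 1::real)"
    unfolding Q_def by (rule absolutely_integrable_on_const) simp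
  then have "set_integrable lebesgue Q (\<lambda>q. \<bar>det (matrix (g' q))\<bar> * (1 / s (g q)))"
    by (subst set_integrable_cong[OF refl refl pullback])
  moreover have "Q \<in> sets lebesgue"
    by (simp add: Q_def)
  ultimately show ?thesis
    using set_integrable_change_of_variables[OF _ der inj, of "\<lambda>p. 1 / s p"] by (simp add: image)
qed

lemma integrable_vertex_weights:
  "set_integrable lebesgue open_triangle (\<lambda>p. 1 / p$1)"
  "set_integrable lebesgue open_triangle (\<lambda>p. 1 / (1 - p$2))"
  "set_integrable lebesgue open_triangle (\<lambda>p. 1 / (1 - p$1 + p$2))"
  subgoal by (rule integrable_inverse_affine_coordinate[of 1 1 0 0 0 0 _ "\<lambda>p. p$2"];
      auto simp: open_triangle_def)
  subgoal by (rule integrable_inverse_affine_coordinate[of 0 0 "-1" "-1" 1 1 _ "\<lambda>p. 1 - p$1"];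
      auto simp: open_triangle_def)
  subgoal by (rule integrable_inverse_affine_coordinate[of "-1" 1 0 1 1 0 _ "\<lambda>p. p$2"];
      auto simp: open_triangle_def)
  done

text \<open>
  A product of two reciprocals is bounded by their sum because \<open>(1 - v$1) + (1 - v$3) = 1 + v$2 \<ge> 1\<close>:
  the two factors cannot be small simultaneously. The right-hand side is symmetric in the
  coordinates, so that it is unaffected by the permutations that relate the triples.
\<close>
lemma cone_density_le:
  assumes v: "v \<in> pos_cone" and sum: "coord_sum v = 1"
  shows "cone_density \<kappa> v \<le> 1 / (1 - v$1) + 1 / (1 - v$2) + 1 / (1 - v$3)"
proof -
  have eq: "v$2 + v$3 = 1 - v$1" "v$1 + v$2 = 1 - v$3"
    and pos: "0 < v$1" "0 < v$2" "0 < v$3" "0 < 1 - v$1" "0 < 1 - v$2" "0 < 1 - v$3"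
    using v sum by (auto simp: pos_cone_def coord_sum_def)
  show ?thesis
  proof (cases "\<kappa> = S3_e")
    case True
    have "1 / ((1 - v$1) * (1 + v$3)) \<le> 1 / (1 - v$1)"
      using pos by (intro divide_left_mono) (auto simp: mult_le_cancel_left1)
    moreover have "0 < 1 / (1 - v$2)" "0 < 1 / (1 - v$3)"
      using pos by simp_all
    moreover have "cone_density \<kappa> v = 1 / ((1 - v$1) * (1 + v$3))"
      unfolding cone_density_def sum eq using True by simp
    ultimately show ?thesis
      by linarith
  next
    case False
    have "1 / ((1 - v$1) * (1 - v$3)) \<le> ((1 - v$1) + (1 - v$3)) / ((1 - v$1) * (1 - v$3))"
      using pos eq by (intro divide_right_mono) auto
    also have "\<dots> = 1 / (1 - v$1) + 1 / (1 - v$3)"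
      using pos(4,6) add_frac_eq[of "1 - v$1" "1 - v$3" 1 1] by simp
    finally have "1 / ((1 - v$1) * (1 - v$3)) \<le> 1 / (1 - v$1) + 1 / (1 - v$3)" .
    moreover have "0 < 1 / (1 - v$2)"
      using pos by simp
    moreover have "cone_density \<kappa> v = 1 / ((1 - v$1) * (1 - v$3))"
      unfolding cone_density_def sum eq using False by simp
    ultimately show ?thesis
      by linarith
  qed
qed

lemma continuous_on_barycentric: "continuous_on A barycentric"
proof -
  have eq: "barycentric = (\<lambda>p. (1 - p$1) *\<^sub>R axis 1 1 + (p$1 - p$2) *\<^sub>R axis 2 1 + p$2 *\<^sub>R axis 3 1)"
    by (simp add: fun_eq_iff barycentric_def vec_eq_iff forall_3 axis_def)
  show ?thesis
    unfolding eq by (intro continuous_intros)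
qed

lemma continuous_on_cone_density: "continuous_on pos_cone (cone_density \<kappa>)"
  unfolding cone_density_def coord_sum_def
  by (cases "\<kappa> = S3_e") (auto simp: pos_cone_def intro!: continuous_intros)

lemma perm_barycentric_in_pos_cone:
  "p \<in> open_triangle \<Longrightarrow> perm_mat \<rho> *v barycentric p \<in> pos_cone"
  by (simp add: barycentric_in_pos_cone pos_cone_perm_mat)

lemma continuous_on_density:
  "continuous_on open_triangle (\<lambda>p. cone_density \<kappa> (perm_mat \<rho> *v barycentric p))"
proof -
  have "continuous_on open_triangle (\<lambda>p. perm_mat \<rho> *v barycentric p)"
    by (intro bounded_linear.continuous_on[OF matrix_vector_mul_bounded_linear] continuous_on_barycentric)
  then show ?thesis
    by (rule continuous_on_compose2[OF continuous_on_cone_density]) (auto simp: perm_barycentric_in_pos_cone)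
qed

lemma integrable_density:
  "set_integrable lebesgue open_triangle (\<lambda>p. cone_density \<kappa> (perm_mat \<rho> *v barycentric p))"
    (is "set_integrable _ _ ?h")
proof (rule set_integrable_bound)
  let ?b = "\<lambda>p::real^2. 1 / p$1 + 1 / (1 - p$2) + 1 / (1 - p$1 + p$2)"
  show "set_integrable lebesgue open_triangle ?b"
    by (intro set_integral_add integrable_vertex_weights)
  have "?h \<in> borel_measurable (lebesgue_on open_triangle)"
    using continuous_on_density open_open_triangle by (simp add: continuous_imp_measurable_on_sets_lebesgue)
  then show "set_borel_measurable lebesgue open_triangle ?h"
    using open_open_triangle by (simp add: borel_measurable_restrict_space_iff set_borel_measurable_def)
  have "\<bar>?h p\<bar> \<le> \<bar>?b p\<bar>" if p: "p \<in> open_triangle" for p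
  proof -
    let ?v = "perm_mat \<rho> *v barycentric p"
    have "coord_sum ?v = 1"
      by (simp add: coord_sum_perm_mat coord_sum_barycentric)
    then have "?h p \<le> 1 / (1 - ?v$1) + 1 / (1 - ?v$2) + 1 / (1 - ?v$3)"
      using cone_density_le perm_barycentric_in_pos_cone p by blast
    also have "\<dots> = ?b p"
      by (cases \<rho>) (simp_all add: perm_mat_apply barycentric_def algebra_simps)
    finally show ?thesis
      using cone_density_pos[OF perm_barycentric_in_pos_cone[OF p], of \<kappa> \<rho>] by linarith
  qed
  then show "AE p in lebesgue. p \<in> open_triangle \<longrightarrow> norm (?h p) \<le> norm (?b p)"
    by auto
qed

section \<open>Fixed densities of the 18 triangle partition maps\<close>

lemma full_branch_density_tpm:
  assumes \<kappa>: "\<kappa> \<in> {S3_e, S3_23, S3_132}"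
    and \<sigma>\<tau>1: "\<And>v. perm_mat \<tau>1 *v (perm_mat \<sigma> *v v) = v"
    and \<tau>0: "\<And>v. perm_mat \<tau>0 *v v = perm_mat \<kappa> *v (perm_mat \<tau>1 *v v)"
  shows "full_branch_density open_triangle (branch \<sigma> \<tau>0 \<tau>1)
     (\<lambda>k. projective_deriv (hom_branch_mat \<sigma> \<tau>0 \<tau>1 k)) (tpm_dom \<sigma> \<tau>0 \<tau>1) (tpm \<sigma> \<tau>0 \<tau>1)
     (\<lambda>p. if p \<in> open_triangle then cone_density \<kappa> (perm_mat \<tau>1 *v barycentric p) else 0)"
proof -
  interpret full_branch_map open_triangle "branch \<sigma> \<tau>0 \<tau>1"
    "\<lambda>k. projective_deriv (hom_branch_mat \<sigma> \<tau>0 \<tau>1 k)" "tpm_dom \<sigma> \<tau>0 \<tau>1" "tpm \<sigma> \<tau>0 \<tau>1"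
    by (rule full_branch_map_tpm)
  let ?H = "\<lambda>v. cone_density \<kappa> (perm_mat \<tau>1 *v v)"
  show ?thesis
  proof (unfold_locales, goal_cases)
    case 1
    show ?case
      using continuous_on_density[of \<kappa> \<tau>1] by (simp cong: continuous_on_cong_simp)
  next
    case (2 p)
    then show ?case
      by (simp add: cone_density_pos perm_barycentric_in_pos_cone)
  next
    case (3 p)
    then show ?case
      by simp
  next
    case 4
    show ?case
      using integrable_density[of \<kappa> \<tau>1] by (simp cong: set_integrable_cong)
  next
    case (5 p)
    have "jac k p * ?H (barycentric (branch \<sigma> \<tau>0 \<tau>1 k p)) = ?H (branch_mat \<sigma> \<tau>0 \<tau>1 k *v barycentric p)" for k
      using branch_denom_pos[OF 5, of \<sigma> \<tau>0 \<tau>1 k]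
      by (simp add: jac_tpm[OF 5] barycentric_branch[OF 5] matrix_vector_mult_scaleR cone_density_scale
          power_one_over)
    moreover have "(\<lambda>k. ?H (branch_mat \<sigma> \<tau>0 \<tau>1 k *v barycentric p)) sums ?H (barycentric p)"
      using cone_density_fixed[OF \<kappa> perm_barycentric_in_pos_cone[OF 5]]
      by (simp add: branch_mat_conj[OF \<sigma>\<tau>1 \<tau>0])
    ultimately show ?case
      using 5 by (simp add: branch_in_triangle)
  qed
qed

text \<open>
  The weights, as functions of the permuted barycentric coordinates of a point. For \<open>\<kappa> = e\<close> two
  weights occur, since \<open>(123, 132, 132)\<close> comes with \<open>(1 - y) (1 + x - y)\<close> while its conjugates drop the second
  factor, which lies between 1 and 2.
\<close>
definition matching_weight :: "S3 \<Rightarrow> real \<Rightarrow> real^3 \<Rightarrow> bool" where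
  "matching_weight \<kappa> r v \<longleftrightarrow>
    (if \<kappa> = S3_e then r = v$2 + v$3 \<or> r = (v$2 + v$3) * (1 + v$3)
     else r = (v$2 + v$3) * (v$1 + v$2))"

lemma matching_weight_bounds:
  assumes v: "v \<in> pos_cone" and sum: "coord_sum v = 1" and r: "matching_weight \<kappa> r v"
  shows "0 < r" "1 / 2 \<le> r * cone_density \<kappa> v" "r * cone_density \<kappa> v \<le> 1"
proof -
  have pos: "0 < v$1" "0 < v$2" "0 < v$3" "v$3 < 1"
    using v sum by (auto simp: pos_cone_def coord_sum_def)
  then show "0 < r"
    using r by (auto simp: matching_weight_def split: if_splits)
  have "1 / 2 \<le> 1 / (1 + v$3)" "1 / (1 + v$3) \<le> 1"
    using pos by (auto intro!: divide_left_mono)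
  moreover have "r * cone_density \<kappa> v = 1 \<or> r * cone_density \<kappa> v = 1 / (1 + v$3)"
    using r pos by (auto simp: matching_weight_def cone_density_def sum split: if_splits)
  ultimately show "1 / 2 \<le> r * cone_density \<kappa> v" "r * cone_density \<kappa> v \<le> 1"
    by auto
qed

lemma tpm_weights_conjugate:
  assumes "((\<sigma>, \<tau>0, \<tau>1), g) \<in> tpm_weights"
  shows "\<exists>\<kappa>\<in>{S3_e, S3_23, S3_132}.
    (\<forall>v. perm_mat \<tau>1 *v (perm_mat \<sigma> *v v) = v) \<and>
    (\<forall>v. perm_mat \<tau>0 *v v = perm_mat \<kappa> *v (perm_mat \<tau>1 *v v)) \<and>
    (\<forall>p. matching_weight \<kappa> (g (p$1) (p$2)) (perm_mat \<tau>1 *v barycentric p))"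
  using assms unfolding tpm_weights_def
  by (simp only: insert_iff empty_iff prod.inject, elim disjE conjE FalseE)
    (simp_all add: perm_mat_apply matching_weight_def barycentric_def vec_eq_iff forall_3 algebra_simps)

text \<open>The weighted space depends on the weight only up to factors bounded above and below, so that
  the reciprocal of \<open>h\<close> may replace it.\<close>
lemma weighted_space_eq:
  assumes "\<And>p. p \<in> open_triangle \<Longrightarrow> 0 < g (p$1) (p$2)"
    and lower: "\<And>p. p \<in> open_triangle \<Longrightarrow> 1 / 2 \<le> g (p$1) (p$2) * h p"
    and upper: "\<And>p. p \<in> open_triangle \<Longrightarrow> g (p$1) (p$2) * h p \<le> 1"
  shows "weighted_space g = {f. continuous_on open_triangle f \<and> (\<forall>p. p \<notin> open_triangle \<longrightarrow> f p = 0) \<and>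
    (\<exists>C. \<forall>p\<in>open_triangle. \<bar>f p\<bar> \<le> C * h p)}"
proof -
  have "(\<exists>C. \<forall>p\<in>open_triangle. \<bar>g (p$1) (p$2) * f p\<bar> < C) \<longleftrightarrow>
      (\<exists>C. \<forall>p\<in>open_triangle. \<bar>f p\<bar> \<le> C * h p)" for f :: "real^2 \<Rightarrow> real"
  proof
    assume "\<exists>C. \<forall>p\<in>open_triangle. \<bar>g (p$1) (p$2) * f p\<bar> < C"
    then obtain C where C: "\<And>p. p \<in> open_triangle \<Longrightarrow> \<bar>g (p$1) (p$2) * f p\<bar> < C"
      by blast
    have "\<bar>f p\<bar> \<le> (2 * C) * h p" if p: "p \<in> open_triangle" for p
    proof -
      let ?r = "g (p$1) (p$2)"
      have r: "0 < ?r" using assms(1)[OF p] .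
      have "0 \<le> C" using C[OF p] by linarith
      then have "C * 1 \<le> C * (2 * (?r * h p))"
        using lower[OF p] by (intro mult_left_mono) auto
      moreover have "?r * \<bar>f p\<bar> \<le> C"
        using C[OF p] r by (simp add: abs_mult)
      ultimately have "?r * \<bar>f p\<bar> \<le> ?r * (2 * C * h p)"
        by (simp add: mult_ac)
      then show ?thesis
        using r by simp
    qed
    then show "\<exists>C. \<forall>p\<in>open_triangle. \<bar>f p\<bar> \<le> C * h p"
      by blast
  next
    assume "\<exists>C. \<forall>p\<in>open_triangle. \<bar>f p\<bar> \<le> C * h p"
    then obtain C where C: "\<And>p. p \<in> open_triangle \<Longrightarrow> \<bar>f p\<bar> \<le> C * h p"
      by blast
    have "\<bar>g (p$1) (p$2) * f p\<bar> < \<bar>C\<bar> + 1" if p: "p \<in> open_triangle" for p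
    proof -
      let ?r = "g (p$1) (p$2)"
      have r: "0 < ?r" using assms(1)[OF p] .
      have "\<bar>?r * f p\<bar> \<le> ?r * (C * h p)"
        using C[OF p] r by (simp add: abs_mult)
      also have "\<dots> = C * (?r * h p)"
        by simp
      also have "\<dots> \<le> \<bar>C\<bar> * (?r * h p)"
        using lower[OF p] by (intro mult_right_mono) auto
      also have "\<dots> \<le> \<bar>C\<bar> * 1"
        using upper[OF p] by (intro mult_left_mono) auto
      finally show ?thesis
        by simp
    qed
    then show "\<exists>C. \<forall>p\<in>open_triangle. \<bar>g (p$1) (p$2) * f p\<bar> < C"
      by blast
  qed
  then show ?thesis
    by (simp add: weighted_space_def)
qed

theorem theorem6:
  fixes \<sigma> \<tau>0 \<tau>1 :: S3 and g :: "real \<Rightarrow> real \<Rightarrow> real"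
  assumes "((\<sigma>, \<tau>0, \<tau>1), g) \<in> tpm_weights"
    and "ergodic_on (lebesgue_on open_triangle) (tpm_dom \<sigma> \<tau>0 \<tau>1) (tpm \<sigma> \<tau>0 \<tau>1)"
  shows "real_fun.dim
           (eigenspace (transfer_op (tpm_dom \<sigma> \<tau>0 \<tau>1) (tpm \<sigma> \<tau>0 \<tau>1)) (weighted_space g) 1) = 1"
proof -
  obtain \<kappa> where \<kappa>: "\<kappa> \<in> {S3_e, S3_23, S3_132}"
    and \<sigma>\<tau>1: "\<And>v. perm_mat \<tau>1 *v (perm_mat \<sigma> *v v) = v"
    and \<tau>0: "\<And>v. perm_mat \<tau>0 *v v = perm_mat \<kappa> *v (perm_mat \<tau>1 *v v)"
    and weight: "\<And>p. matching_weight \<kappa> (g (p$1) (p$2)) (perm_mat \<tau>1 *v barycentric p)"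
    using tpm_weights_conjugate[OF assms(1)] by blast
  define h where
    "h = (\<lambda>p. if p \<in> open_triangle then cone_density \<kappa> (perm_mat \<tau>1 *v barycentric p) else 0)"
  interpret full_branch_density open_triangle "branch \<sigma> \<tau>0 \<tau>1"
    "\<lambda>k. projective_deriv (hom_branch_mat \<sigma> \<tau>0 \<tau>1 k)" "tpm_dom \<sigma> \<tau>0 \<tau>1" "tpm \<sigma> \<tau>0 \<tau>1" h
    unfolding h_def by (rule full_branch_density_tpm[OF \<kappa> \<sigma>\<tau>1 \<tau>0])
  have bounds: "0 < g (p$1) (p$2)" "1 / 2 \<le> g (p$1) (p$2) * h p" "g (p$1) (p$2) * h p \<le> 1"
    if "p \<in> open_triangle" for p
    using matching_weight_bounds[OF perm_barycentric_in_pos_cone[OF that] _ weight]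
    by (simp_all add: that h_def coord_sum_perm_mat coord_sum_barycentric)
  have "vector [1/2, 1/4] \<in> open_triangle"
    by (simp add: open_triangle_def)
  then have "open_triangle \<noteq> {}"
    by blast
  moreover have "weighted_space g = {f. continuous_on open_triangle f \<and>
      (\<forall>p. p \<notin> open_triangle \<longrightarrow> f p = 0) \<and> (\<exists>C. \<forall>p\<in>open_triangle. \<bar>f p\<bar> \<le> C * h p)}"
    using bounds by (rule weighted_space_eq)
  ultimately show ?thesis
    by (rule dim_eigenspace[OF assms(2)])
qed

end
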